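(* Let $\mathcal{L}=\sum_{k=1}^{n}\lambda_k\mathcal{L}_k$ be a generator as described in the context, with $\Gamma=\sum_{k=1}^n\lambda_k>0$, and let $t\ge 0$. Let $r$ be a positive integer such that $r\Gamma$ is a positive integer. Then $$\big\|\Lambda(t)-\mathcal{E}(t/r)^{r\Gamma}\big\|_{\diamond}\;\le\;\frac{t^{2}\sum_{k=1}^{n}\lambda_{k}\|\mathcal{L}_{k}\|_{\diamond}^{2}}{r}.$$ In particular, for any $\epsilon>0$, if $$r\;\ge\;\left\lceil \frac{t^{2}}{\epsilon}\sum_{k=1}^{n}\lambda_{k}\|\mathcal{L}_{k}\|_{\diamond}^{2}\right\rceil$$ (and $r\Gamma$ is an integer), then $\|\Lambda(t)-\mathcal{E}(t/r)^{r\Gamma}\|_{\diamond}\le\epsilon$.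
   Context: Work on $d\times d$ complex matrices. A superoperator is a linear map on $d\times d$ matrices; its diamond norm is $\|\Phi\|_\diamond=\sup\{\|(\Phi\otimes\mathrm{id}_d)(X)\|_1:\|X\|_1\le 1\}$, where $\|\cdot\|_1$ is the trace norm. The generator is $\mathcal{L}=\sum_{k=1}^{n}\lambda_k\mathcal{L}_k$ with $\lambda_k\ge 0$, where each term $\mathcal{L}_k$ is either a Hamiltonian term $\mathcal{L}_k(\rho)=-i[H_k,\rho]$ with $H_k$ Hermitian, or a dissipative term $\mathcal{L}_k(\rho)=L_k\rho L_k^\dagger-\tfrac12\{L_k^\dagger L_k,\rho\}$ with $L_k$ a $d\times d$ matrix; in either case $e^{s\mathcal{L}_k}$ is completely positive and trace preserving (CPTP) for all $s\ge 0$, and so is $e^{s\mathcal{L}}$. Define $\Lambda(t)=\exp(t\mathcal{L})$, $\Gamma=\sum_{k=1}^n\lambda_k$, $p_k=\lambda_k/\Gamma$, and the qDRIFT channel $\mathcal{E}(\tau)=\sum_{k=1}^{n}p_k\exp(\tau\mathcal{L}_k)$ for $\tau\ge 0$. Powers of superoperators denote repeated composition. *)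

theory Defs
  imports "HOL-Analysis.Analysis"
begin

type_synonym 'd cmat = "complex^'d^'d"
type_synonym 'd sop = "'d cmat \<Rightarrow> 'd cmat"

definition smat :: "complex \<Rightarrow> complex^'n^'m \<Rightarrow> complex^'n^'m" where
  "smat c A = (\<chi> i j. c * A $ i $ j)"

definition madj :: "complex^'n^'m \<Rightarrow> complex^'m^'n" where
  "madj A = (\<chi> i j. cnj (A $ j $ i))"

definition hermitian :: "complex^'n^'n \<Rightarrow> bool" where
  "hermitian A \<longleftrightarrow> madj A = A"

definition psd :: "complex^'n^'n \<Rightarrow> bool" where
  "psd A \<longleftrightarrow> hermitian A \<and>
     (\<forall>x::complex^'n. 0 \<le> Re (\<Sum>i\<in>UNIV. \<Sum>j\<in>UNIV. cnj (x $ i) * A $ i $ j * x $ j))"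

definition psd_sqrt :: "complex^'n^'n \<Rightarrow> complex^'n^'n" where
  "psd_sqrt A = (THE S. psd S \<and> S ** S = A)"

definition trace_norm :: "complex^'n^'n \<Rightarrow> real" where
  "trace_norm X = Re (trace (psd_sqrt (madj X ** X)))"

text \<open>(Phi \<otimes> id_d)(X) for X acting on C^d \<otimes> C^d, indices (system, ancilla)\<close>
definition tensor_id :: "('d::finite) sop \<Rightarrow> complex^('d\<times>'d)^('d\<times>'d) \<Rightarrow> complex^('d\<times>'d)^('d\<times>'d)" where
  "tensor_id \<Phi> X = (\<chi> p q. \<Phi> (\<chi> a b. X $ (a, snd p) $ (b, snd q)) $ fst p $ fst q)"

definition diamond_norm :: "('d::finite) sop \<Rightarrow> real" where
  "diamond_norm \<Phi> = (SUP X\<in>{X :: complex^('d\<times>'d)^('d\<times>'d). trace_norm X \<le> 1}.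
                         trace_norm (tensor_id \<Phi> X))"

definition sop_exp :: "real \<Rightarrow> ('d::finite) sop \<Rightarrow> 'd sop" where
  "sop_exp s L = (\<lambda>X. (\<Sum>m. ((s ^ m) / fact m) *\<^sub>R (L ^^ m) X))"

datatype ('d::finite) lterm = Ham "complex^'d^'d" | Diss "complex^'d^'d"

fun lterm_valid :: "('d::finite) lterm \<Rightarrow> bool" where
  "lterm_valid (Ham H) = hermitian H"
| "lterm_valid (Diss L) = True"

fun lterm_sop :: "('d::finite) lterm \<Rightarrow> 'd sop" where
  "lterm_sop (Ham H) = (\<lambda>\<rho>. smat (-\<i>) (H ** \<rho> - \<rho> ** H))"
| "lterm_sop (Diss L) = (\<lambda>\<rho>. L ** \<rho> ** madj L
       - smat (1/2) (madj L ** L ** \<rho> + \<rho> ** (madj L ** L)))"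

definition generator :: "nat \<Rightarrow> (nat \<Rightarrow> real) \<Rightarrow> (nat \<Rightarrow> ('d::finite) lterm) \<Rightarrow> 'd sop" where
  "generator n lam T = (\<lambda>\<rho>. \<Sum>k=1..n. lam k *\<^sub>R lterm_sop (T k) \<rho>)"

definition qdrift :: "nat \<Rightarrow> (nat \<Rightarrow> real) \<Rightarrow> (nat \<Rightarrow> ('d::finite) lterm) \<Rightarrow> real \<Rightarrow> 'd sop" where
  "qdrift n lam T \<tau> = (\<lambda>\<rho>. \<Sum>k=1..n. (lam k / (\<Sum>j=1..n. lam j)) *\<^sub>R sop_exp \<tau> (lterm_sop (T k)) \<rho>)"

end

theory Submission
  imports Defs
begin

text \<open>In the Banach algebra of superoperators with the diamond norm, both \<open>exp (\<tau> M)\<close> with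
  \<open>M = \<Sum> p\<^sub>k L\<^sub>k\<close> and \<open>\<Sum> p\<^sub>k exp (\<tau> L\<^sub>k)\<close> differ from \<open>1 + \<tau> M\<close> by at most
  \<open>\<tau>\<^sup>2 / 2 * \<Sum> p\<^sub>k \<parallel>L\<^sub>k\<parallel>\<^sup>2\<close>, and both are contractions, so the errors of the \<open>N\<close> steps
  add up. That the exponentials are contractions is obtained without complete positivity of
  \<open>exp (s L\<^sub>k)\<close>, from the Euler steps \<open>\<parallel>1 + h L\<^sub>k\<parallel> \<le> 1 + O(h\<^sup>2)\<close>. The facts about the trace
  norm rest on its duality with the operator norm, which comes from maximising \<open>Re tr (U X)\<close>
  over the compact unitary group.\<close>

section \<open>Complex matrices\<close>

text \<open>The remainders stay quadratic, with no factor growing like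
  \<open>exp (\<tau> * norm a)\<close>, because they are integrated along contractions; hence
  contractivity comes before every error estimate. With \<open>\<tau> = t / r\<close> and
  \<open>N = r * \<Gamma>\<close> one has \<open>N * \<tau> = t * \<Gamma>\<close>, and the factor
  \<Gamma> cancels against the normalisation of the weights \<open>p\<close>. Two definitions shape
  the rest. The square root in \<open>trace_norm\<close> is a definite description, so nothing can
  be said about it before existence and uniqueness of the positive root of
  \<open>madj X ** X\<close> are known. The diamond norm ranges over all matrices on the doubled
  space, not only positive ones, so trace preservation does not bound it directly; estimates are
  made on the dual side, for the adjoint map applied to a contraction.\<close>

lemma matrix_add_rdistrib: "((A::'a::semiring_1^'n^'m) + B) ** (C::'a^'p^'n) = A ** C + B ** C"
  by (simp add: vec_eq_iff matrix_matrix_mult_def sum.distrib distrib_right)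

lemma matrix_diff_ldistrib: "(A::'a::ring_1^'n^'m) ** (B - C) = A ** B - A ** (C::'a^'p^'n)"
  by (simp add: vec_eq_iff matrix_matrix_mult_def sum_subtractf right_diff_distrib)

lemma matrix_diff_rdistrib: "((A::'a::ring_1^'n^'m) - B) ** (C::'a^'p^'n) = A ** C - B ** C"
  by (simp add: vec_eq_iff matrix_matrix_mult_def sum_subtractf left_diff_distrib)

lemmas matrix_distribs =
  matrix_add_ldistrib matrix_add_rdistrib matrix_diff_ldistrib matrix_diff_rdistrib

lemma smat_mult_left: "smat c A ** B = smat c (A ** B)"
  by (simp add: vec_eq_iff smat_def matrix_matrix_mult_def sum_distrib_left mult.assoc)

lemma smat_mult_right: "A ** smat c B = smat c (A ** B)"
  by (simp add: vec_eq_iff smat_def matrix_matrix_mult_def sum_distrib_left mult.left_commute)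

lemma smat_smat: "smat a (smat b A) = smat (a * b) A"
  by (simp add: vec_eq_iff smat_def mult.assoc)

lemma smat_add: "smat c (A + B) = smat c A + smat c B"
  by (simp add: vec_eq_iff smat_def distrib_left)

lemma smat_diff: "smat c (A - B) = smat c A - smat c B"
  by (simp add: vec_eq_iff smat_def right_diff_distrib)

lemma smat_of_real: "smat (of_real r) A = r *\<^sub>R A"
  by (simp add: vec_eq_iff smat_def complex_eq_iff)

lemma smat_vector: "smat c A *v x = c *s (A *v x)"
  by (simp add: vec_eq_iff smat_def matrix_vector_mult_def sum_distrib_left mult.assoc)

lemma trace_smat: "trace (smat c A) = c * trace A"
  by (simp add: trace_def smat_def sum_distrib_left)

lemma trace_scaleR: "trace (r *\<^sub>R (A::complex^'n^'n)) = r *\<^sub>R trace A"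
  by (simp add: trace_def scaleR_sum_right)

lemma madj_madj [simp]: "madj (madj A) = A"
  by (simp add: vec_eq_iff madj_def)

lemma madj_mult: "madj (A ** B) = madj B ** madj A"
  by (simp add: vec_eq_iff madj_def matrix_matrix_mult_def mult.commute)

lemma madj_add: "madj (A + B) = madj A + madj B"
  by (simp add: vec_eq_iff madj_def)

lemma madj_diff: "madj (A - B) = madj A - madj B"
  by (simp add: vec_eq_iff madj_def)

lemma madj_smat: "madj (smat c A) = smat (cnj c) (madj A)"
  by (simp add: vec_eq_iff madj_def smat_def)

lemma madj_scaleR: "madj (r *\<^sub>R A) = r *\<^sub>R madj A"
  by (simp add: vec_eq_iff madj_def)

lemma madj_mat_1 [simp]: "madj (mat 1) = mat 1"
  by (simp add: vec_eq_iff madj_def mat_def)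

lemma trace_madj: "trace (madj A) = cnj (trace A)"
  by (simp add: trace_def madj_def)

lemma matrix_vector_mult_minus_left: "(- A) *v x = - (A *v (x :: complex^'n))"
  by (simp add: vec_eq_iff matrix_vector_mult_def sum_negf)

lemma scaleR_matrix_vector: "(r *\<^sub>R A) *v x = r *\<^sub>R (A *v (x :: complex^'n))"
  by (simp add: vec_eq_iff matrix_vector_mult_def scaleR_sum_right)

text \<open>The inner product of \<open>complex^'n\<close> as a Euclidean space is the real part of
  the Hermitian one. This links the explicit double sum in \<open>psd\<close> with the library's
  inner product.\<close>

lemma inner_matrix_vector:
  fixes A :: "complex^'n^'m"
  shows "x \<bullet> (A *v y) = Re (\<Sum>i\<in>UNIV. \<Sum>j\<in>UNIV. cnj (x $ i) * A $ i $ j * y $ j)"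
proof -
  have "z \<bullet> w = Re (cnj z * w)" for z w :: complex
    by (simp add: inner_complex_def)
  then have "x \<bullet> (A *v y) = (\<Sum>i\<in>UNIV. Re (cnj (x $ i) * (\<Sum>j\<in>UNIV. A $ i $ j * y $ j)))"
    by (simp only: inner_vec_def matrix_vector_mult_def vec_lambda_beta)
  then show ?thesis
    by (simp only: Re_sum sum_distrib_left mult.assoc)
qed

lemma inner_madj:
  fixes A :: "complex^'n^'m"
  shows "x \<bullet> (A *v y) = (madj A *v x) \<bullet> y"
proof -
  have "(madj A *v x) \<bullet> y = y \<bullet> (madj A *v x)"
    by (rule inner_commute)
  also have "\<dots> = Re (cnj (\<Sum>i\<in>UNIV. \<Sum>j\<in>UNIV. cnj (y $ i) * madj A $ i $ j * x $ j))"
    by (simp only: inner_matrix_vector cnj.simps)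
  also have "\<dots> = Re (\<Sum>i\<in>UNIV. \<Sum>j\<in>UNIV. cnj (x $ j) * A $ j $ i * y $ i)"
    by (simp add: madj_def mult_ac)
  also have "\<dots> = x \<bullet> (A *v y)"
    by (subst sum.swap) (simp only: inner_matrix_vector)
  finally show ?thesis by simp
qed

lemma psd_iff: "psd A \<longleftrightarrow> madj A = A \<and> (\<forall>x. 0 \<le> x \<bullet> (A *v x))"
  by (simp add: psd_def hermitian_def inner_matrix_vector)

lemma matrix_vector_axis: "(A *v axis j 1) $ i = (A $ i $ j :: 'a::semiring_1)"
  by (simp add: matrix_vector_mult_def axis_def if_distrib cong: if_cong)

lemma Re_trace_eq_sum:
  fixes A :: "complex^'n^'n"
  shows "Re (trace A) = (\<Sum>i\<in>UNIV. axis i 1 \<bullet> (A *v axis i 1))"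
  by (simp add: trace_def matrix_vector_axis inner_axis' inner_complex_def)

lemma Re_trace_conj:
  fixes S B :: "complex^'n^'n"
  shows "Re (trace (B ** S ** madj B))
    = (\<Sum>i\<in>UNIV. (madj B *v axis i 1) \<bullet> (S *v (madj B *v axis i 1)))"
  unfolding Re_trace_eq_sum
  by (simp add: inner_madj flip: matrix_vector_mul_assoc)

section \<open>Uniqueness of positive square roots\<close>

lemma psd_inner_eq_0:
  assumes "psd S" and 0: "x \<bullet> (S *v x) = 0"
  shows "S *v x = 0"
proof (rule ccontr)
  define y where "y = S *v x"
  assume "S *v x \<noteq> 0"
  then have y: "y \<bullet> y > 0" by (simp add: y_def)
  have herm: "madj S = S" and pos: "0 \<le> z \<bullet> (S *v z)" for z
    using assms(1) by (auto simp: psd_iff)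
  have lin: "S *v (e *\<^sub>R y) = e *\<^sub>R (S *v y)" for e :: real
    by (simp add: linear_scale)
  define q where "q = y \<bullet> (S *v y)"
  have "x \<bullet> (S *v y) = y \<bullet> y"
    by (simp add: inner_madj[of x] herm y_def)
  then have key: "0 \<le> e * (2 * (y \<bullet> y) + e * q)" for e :: real
    using pos[of "x + e *\<^sub>R y"] 0
    by (simp add: matrix_vector_right_distrib lin inner_add_left inner_add_right q_def
        flip: y_def) (simp add: algebra_simps y_def[symmetric])
  have "q \<ge> 0" by (simp add: q_def pos)
  \<comment> \<open>The form at \<open>x + e *\<^sub>R y\<close> is
    \<open>e * (2 * (y \<bullet> y) + e * q)\<close>. A small negative \<open>e\<close> makes it
    negative, which contradicts positivity; the \<open>+ 1\<close> keeps the denominator positive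
    when \<open>q\<close> is 0.\<close>
  define e where "e = - (y \<bullet> y) / (q + 1)"
  have "e < 0" using y \<open>q \<ge> 0\<close> by (simp add: e_def divide_neg_pos)
  moreover have "e * q \<ge> - (y \<bullet> y)"
    using y \<open>q \<ge> 0\<close> by (simp add: e_def field_simps)
  then have "2 * (y \<bullet> y) + e * q > 0" using y by linarith
  ultimately have "e * (2 * (y \<bullet> y) + e * q) < 0"
    by (rule mult_neg_pos)
  with key show False by (meson not_le)
qed

text \<open>For \<open>D = S - T\<close> the products \<open>D ** (S + T)\<close> and
  \<open>(S + T) ** D\<close> add up to 2 (S^2 - T^2) = 0. Multiplying by \<open>D\<close> and
  taking traces gives tr (D (S + T) D) = 0, a sum of nonnegative terms, so \<open>S\<close> and
  \<open>T\<close> both annihilate every column of \<open>D\<close>. Then D^2 = 0, and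
  \<open>D\<close> is self-adjoint.\<close>

lemma psd_square_unique:
  fixes S T :: "complex^'n^'n"
  assumes S: "psd S" and T: "psd T" and eq: "S ** S = T ** T"
  shows "S = T"
proof -
  define D where "D = S - T"
  have hS: "madj S = S" and hT: "madj T = T" using S T by (auto simp: psd_iff)
  then have hD: "madj D = D" by (simp add: D_def madj_diff)
  have "D ** (S + T) + (S + T) ** D = 0"
    using eq by (simp add: D_def matrix_distribs)
  then have "trace (D ** (D ** (S + T)) + D ** ((S + T) ** D)) = 0"
    by (simp add: trace_def flip: matrix_add_ldistrib)
  moreover have "trace (D ** (D ** (S + T))) = trace (D ** ((S + T) ** D))"
    by (subst trace_mul_sym) (simp add: matrix_mul_assoc)
  ultimately have "trace (D ** (S + T) ** D) = 0"
    by (simp add: trace_add matrix_mul_assoc)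
  then have "Re (trace (D ** S ** madj D)) + Re (trace (D ** T ** madj D)) = 0"
    by (simp only: hD matrix_distribs trace_add flip: plus_complex.sel(1)) simp
  then have sum0: "(\<Sum>i\<in>UNIV. (D *v axis i 1) \<bullet> (S *v (D *v axis i 1))
      + (D *v axis i 1) \<bullet> (T *v (D *v axis i 1))) = 0"
    using Re_trace_conj[of D S] Re_trace_conj[of D T] by (simp add: hD sum.distrib)
  have col: "D *v axis i 1 = 0" for i
  proof -
    let ?v = "D *v axis i 1"
    have "?v \<bullet> (S *v ?v) + ?v \<bullet> (T *v ?v) = 0"
      using sum0 S T by (subst (asm) sum_nonneg_eq_0_iff) (auto simp: psd_iff)
    then have "?v \<bullet> (S *v ?v) = 0" "?v \<bullet> (T *v ?v) = 0"
      using S T by (smt (verit) psd_iff)+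
    then have "S *v ?v = 0" "T *v ?v = 0"
      by (auto intro: psd_inner_eq_0 S T)
    moreover have "D *v ?v = S *v ?v - T *v ?v"
      by (subst D_def) (rule matrix_vector_mult_diff_rdistrib)
    ultimately have "D *v ?v = 0" by simp
    then have "?v \<bullet> ?v = 0"
      by (simp add: inner_madj[of _ D] hD)
    then show ?thesis by simp
  qed
  then have "D = 0"
    by (simp add: vec_eq_iff flip: matrix_vector_axis)
  then show ?thesis by (simp add: D_def)
qed

section \<open>Duality for the trace norm\<close>

definition contraction :: "complex^'n^'n \<Rightarrow> bool" where
  "contraction A \<longleftrightarrow> (\<forall>x. norm (A *v x) \<le> norm x)"

definition unitary :: "complex^'n^'n \<Rightarrow> bool" where
  "unitary U \<longleftrightarrow> madj U ** U = mat 1"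

lemma contraction_mult: "contraction A \<Longrightarrow> contraction B \<Longrightarrow> contraction (A ** B)"
  unfolding contraction_def by (metis matrix_vector_mul_assoc order_trans)

lemma contraction_madj:
  assumes "contraction A" shows "contraction (madj A)"
  unfolding contraction_def
proof
  fix x
  let ?y = "madj A *v x"
  have "norm ?y * norm ?y = x \<bullet> (A *v ?y)"
    by (simp add: inner_madj flip: power2_eq_square power2_norm_eq_inner)
  also have "\<dots> \<le> norm x * norm (A *v ?y)"
    by (rule norm_cauchy_schwarz)
  also have "\<dots> \<le> norm x * norm ?y"
    using assms by (intro mult_left_mono) (auto simp: contraction_def)
  finally show "norm ?y \<le> norm x"
    by (cases "norm ?y = 0") auto
qed

lemma unitary_contraction:
  assumes "unitary U" shows "contraction U"
  unfolding contraction_def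
proof
  fix x
  have "(norm (U *v x))\<^sup>2 = (norm x)\<^sup>2"
    using assms
    by (simp add: power2_norm_eq_inner inner_madj[of _ U] matrix_vector_mul_assoc unitary_def)
  then show "norm (U *v x) \<le> norm x" by simp
qed

lemma unitary_mult: "unitary U \<Longrightarrow> unitary V \<Longrightarrow> unitary (U ** V)"
  unfolding unitary_def madj_mult
  by (metis matrix_mul_assoc matrix_mul_lid)

lemma contraction_entry:
  assumes "contraction A" shows "norm (A $ i $ j) \<le> 1"
proof -
  have "norm (A $ i $ j) \<le> norm (A *v axis j 1)"
    using Finite_Cartesian_Product.norm_nth_le[of "A *v axis j 1" i]
    by (simp only: matrix_vector_axis)
  also have "\<dots> \<le> norm (axis j 1 :: complex^'a)"
    using assms unfolding contraction_def by blast
  finally show ?thesis by (simp add: norm_axis_1)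
qed

text \<open>Entries of a contraction have modulus at most 1. The bound is crude, but it makes
  suprema over contractions finite and bounds the trace norm by the entries.\<close>

lemma norm_trace_contraction_le:
  assumes "contraction A"
  shows "norm (trace (A ** X)) \<le> (\<Sum>i\<in>UNIV. \<Sum>j\<in>UNIV. norm (X $ i $ j))"
proof -
  have "norm (trace (A ** X)) \<le> (\<Sum>i\<in>UNIV. \<Sum>j\<in>UNIV. norm (A $ i $ j * X $ j $ i))"
    unfolding trace_def matrix_matrix_mult_def
    by (simp only: vec_lambda_beta) (intro sum_norm_le norm_sum)
  also have "\<dots> \<le> (\<Sum>i\<in>UNIV. \<Sum>j\<in>UNIV. norm (X $ j $ i))"
    using contraction_entry[OF assms]
    by (intro sum_mono) (simp add: norm_mult mult_left_le_one_le)
  finally show ?thesis by (subst sum.swap)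
qed

lemma compact_unitary: "compact {U :: complex^'n^'n. unitary U}"
proof -
  have "bounded {U :: complex^'n^'n. unitary U}"
    unfolding bounded_iff
  proof (intro exI ballI)
    fix U :: "complex^'n^'n" assume "U \<in> {U. unitary U}"
    then have "contraction U" by (simp add: unitary_contraction)
    have "norm U \<le> (\<Sum>i\<in>UNIV. norm (U $ i))"
      by (simp add: norm_vec_def L2_set_le_sum)
    also have "\<dots> \<le> (\<Sum>i\<in>UNIV. \<Sum>j\<in>UNIV. norm (U $ i $ j))"
      by (intro sum_mono) (simp add: norm_vec_def[of "U $ _"] L2_set_le_sum)
    also have "\<dots> \<le> (\<Sum>i\<in>(UNIV::'n set). \<Sum>j\<in>(UNIV::'n set). 1)"
      by (intro sum_mono contraction_entry \<open>contraction U\<close>)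
    finally show "norm U \<le> (\<Sum>i\<in>(UNIV::'n set). \<Sum>j\<in>(UNIV::'n set). 1)" .
  qed
  moreover have "{U :: complex^'n^'n. unitary U}
      = {U. \<forall>i j. (\<Sum>k\<in>UNIV. cnj (U $ k $ i) * U $ k $ j) = mat 1 $ i $ j}"
    by (auto simp: unitary_def vec_eq_iff madj_def matrix_matrix_mult_def)
  then have "closed {U :: complex^'n^'n. unitary U}"
    by (simp only:) (intro closed_Collect_all closed_Collect_eq continuous_intros)
  ultimately show ?thesis by (simp add: compact_eq_bounded_closed)
qed

section \<open>Positivity from maximality over the unitary group\<close>

definition outer :: "complex^'n \<Rightarrow> complex^'n^'n" where
  "outer v = (\<chi> i j. v $ i * cnj (v $ j))"

lemma trace_outer_mult:
  "trace (outer v ** A) = (\<Sum>i\<in>UNIV. \<Sum>j\<in>UNIV. cnj (v $ i) * A $ i $ j * v $ j)"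
  unfolding trace_def outer_def matrix_matrix_mult_def
  by (simp, subst sum.swap) (simp add: mult_ac)

lemma madj_outer: "madj (outer v) = outer v"
  by (simp add: vec_eq_iff madj_def outer_def)

lemma outer_idem:
  assumes "norm v = 1" shows "outer v ** outer v = outer v"
proof -
  have "(\<Sum>k\<in>UNIV. cnj (v $ k) * v $ k) = of_real ((norm v)\<^sup>2)"
    by (simp add: power2_norm_eq_inner inner_vec_def mult.commute complex_norm_square)
       (simp add: complex_mult_cnj inner_complex_def power2_eq_square)
  then have "(\<Sum>k\<in>UNIV. cnj (v $ k) * v $ k) = 1" using assms by simp
  moreover have "(\<Sum>k\<in>UNIV. v $ i * cnj (v $ k) * (v $ k * cnj (v $ j)))
      = v $ i * (\<Sum>k\<in>UNIV. cnj (v $ k) * v $ k) * cnj (v $ j)" for i j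
    by (simp add: sum_distrib_left sum_distrib_right mult.assoc)
  ultimately show ?thesis
    by (simp add: vec_eq_iff outer_def matrix_matrix_mult_def)
qed

text \<open>This matrix multiplies the direction of \<open>v\<close> by the phase \<open>w\<close>
  and fixes the orthogonal complement of \<open>v\<close>. It is the perturbation against which a
  maximising unitary is tested.\<close>

lemma unitary_phase_outer:
  assumes v: "norm v = 1" and w: "norm w = 1"
  shows "unitary (mat 1 + smat (w - 1) (outer v))"
proof -
  have "cnj w * w = 1" using w by (metis complex_norm_square mult.commute of_real_1 power_one)
  then have c: "(w - 1) + (cnj w - 1) + (cnj w - 1) * (w - 1) = 0"
    by (simp add: algebra_simps)
  have "madj (mat 1 + smat (w - 1) (outer v)) ** (mat 1 + smat (w - 1) (outer v))
      = mat 1 + smat ((w - 1) + (cnj w - 1) + (cnj w - 1) * (w - 1)) (outer v)"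
    by (simp add: madj_add madj_smat madj_outer matrix_distribs smat_mult_left smat_mult_right
        outer_idem[OF v] smat_smat)
       (simp add: vec_eq_iff smat_def algebra_simps)
  also have "\<dots> = mat 1" unfolding c by (simp add: vec_eq_iff smat_def)
  finally show ?thesis by (simp add: unitary_def)
qed

text \<open>Polarisation at \<open>u + v\<close>. Since the inner product is only a real part, a
  vanishing quadratic form kills just the self-adjoint part of \<open>G\<close>.\<close>

lemma skew_if_inner_zero:
  fixes G :: "complex^'n^'n"
  assumes 0: "\<And>v. v \<bullet> (G *v v) = 0"
  shows "madj G = - G"
proof -
  have "u \<bullet> ((G + madj G) *v v) = 0" for u v
  proof -
    have "u \<bullet> (G *v v) + v \<bullet> (G *v u) = 0"
      using 0[of "u + v"] 0[of u] 0[of v]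
      by (simp add: matrix_vector_right_distrib inner_add_left inner_add_right)
    then show ?thesis
      by (simp add: matrix_vector_mult_add_rdistrib inner_add_right inner_madj[of v] inner_commute)
  qed
  then have "(G + madj G) *v v = 0" for v
    by (metis inner_eq_zero_iff)
  then have "G + madj G = 0"
    by (subst matrix_eq) simp
  then show ?thesis by (simp add: add_eq_0_iff)
qed

text \<open>A unitary maximising \<open>Re tr (U X)\<close> turns \<open>X\<close> into a positive matrix: multiplying \<open>U\<close> by
  \<open>1 + (w - 1) v v\<^sup>*\<close> cannot increase the value, hence \<open>Re (w z) \<le> Re z\<close> for all phases \<open>w\<close>,
  where \<open>z = v\<^sup>* U X v\<close>. This gives the polar decomposition without the spectral theorem.\<close>
lemma polar_decomposition:
  fixes X :: "complex^'n^'n"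
  obtains U where "unitary U" and "psd (U ** X)"
proof -
  have "unitary (mat 1 :: complex^'n^'n)" by (simp add: unitary_def)
  then have "{U :: complex^'n^'n. unitary U} \<noteq> {}" by blast
  moreover have "continuous_on {U. unitary U} (\<lambda>U :: complex^'n^'n. Re (trace (U ** X)))"
    unfolding trace_def matrix_matrix_mult_def vec_lambda_beta by (intro continuous_intros)
  ultimately obtain U :: "complex^'n^'n" where U: "unitary U"
    and max: "\<And>V. unitary V \<Longrightarrow> Re (trace (V ** X)) \<le> Re (trace (U ** X))"
    using continuous_attains_sup[OF compact_unitary] by (metis mem_Collect_eq)
  define S where "S = U ** X"
  define q where "q v = trace (outer v ** S)" for v
  have q_unit: "q v = of_real (norm (q v))" if v: "norm v = 1" for v
  proof (cases "q v = 0")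
    case False
    \<comment> \<open>The phase that rotates \<open>q v\<close> onto the positive real axis;
      maximality of \<open>U\<close> then forces \<open>q v\<close> to lie there already.\<close>
    define w where "w = cnj (q v) / of_real (norm (q v))"
    have w: "norm w = 1" using False by (simp add: w_def norm_divide)
    have wq: "w * q v = of_real (norm (q v))"
      using False
      by (simp add: w_def field_simps power2_eq_square flip: complex_norm_square)
    have "Re (trace (((mat 1 + smat (w - 1) (outer v)) ** U) ** X)) \<le> Re (trace S)"
      unfolding S_def by (intro max unitary_mult unitary_phase_outer U v w)
    also have "((mat 1 + smat (w - 1) (outer v)) ** U) ** X = S + smat (w - 1) (outer v ** S)"
      by (simp add: S_def matrix_distribs smat_mult_left matrix_mul_assoc)
    finally have "Re ((w - 1) * q v) \<le> 0"
      by (simp add: trace_add trace_smat q_def)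
    then have "norm (q v) \<le> Re (q v)"
      by (simp only: left_diff_distrib wq minus_complex.sel) simp
    then have "Re (q v) = norm (q v)" by (meson antisym complex_Re_le_cmod)
    then have "Im (q v) = 0" using cmod_power2[of "q v"] by simp
    with \<open>Re (q v) = norm (q v)\<close> show ?thesis by (simp add: complex_eq_iff)
  qed auto
  have q_scale: "q (r *\<^sub>R v) = of_real (r\<^sup>2) * q v" for r v
  proof -
    have "outer (r *\<^sub>R v) = smat (of_real (r\<^sup>2)) (outer v)"
      by (simp add: vec_eq_iff outer_def smat_def power2_eq_square scaleR_conv_of_real[where 'a=complex] mult_ac)
    then show ?thesis by (simp add: q_def smat_mult_left trace_smat)
  qed
  have q: "0 \<le> Re (q v) \<and> Im (q v) = 0" for v
  proof (cases "v = 0")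
    case True
    then show ?thesis by (simp add: q_def trace_outer_mult)
  next
    case False
    define u where "u = v /\<^sub>R norm v"
    have "norm u = 1" "v = norm v *\<^sub>R u" using False by (auto simp: u_def)
    then have "q v = of_real ((norm v)\<^sup>2 * norm (q u))"
      by (metis of_real_mult q_scale q_unit)
    then show ?thesis by simp
  qed
  \<comment> \<open>The right-hand side is the imaginary part of \<open>q v\<close>, which is 0.
    Hence \<open>smat (- \<i>) S\<close> is skew-adjoint, that is, \<open>S\<close> is
    self-adjoint.\<close>
  have "v \<bullet> (smat (- \<i>) S *v v) = Re (- \<i> * q v)" for v
    unfolding inner_matrix_vector q_def trace_outer_mult
    by (simp only: smat_def vec_lambda_beta sum_distrib_left mult_ac)
  then have "madj (smat (- \<i>) S) = - smat (- \<i>) S"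
    by (intro skew_if_inner_zero) (simp add: q)
  then have "smat (- \<i>) (smat \<i> (madj S)) = smat (- \<i>) (- smat (- \<i>) S)"
    by (simp add: madj_smat)
  then have "madj S = S"
    by (simp add: vec_eq_iff smat_def)
  moreover have "0 \<le> v \<bullet> (S *v v)" for v
    using q[of v] by (simp only: inner_matrix_vector q_def trace_outer_mult)
  ultimately have "psd (U ** X)" by (simp add: psd_iff flip: S_def)
  with U show ?thesis by (rule that)
qed

text \<open>The positive matrix \<open>U ** X\<close> squares to \<open>madj X ** X\<close>, so by
  uniqueness it is the root that the definite description in \<open>psd_sqrt\<close> picks.\<close>

lemma trace_norm_eq_trace_unitary:
  fixes X :: "complex^'n^'n"
  assumes "unitary U" "psd (U ** X)"
  shows "trace_norm X = Re (trace (U ** X))"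
proof -
  let ?S = "U ** X"
  have "?S ** ?S = madj ?S ** ?S" using assms(2) by (simp add: psd_iff)
  also have "\<dots> = madj X ** (madj U ** U) ** X" by (simp add: madj_mult matrix_mul_assoc)
  also have "\<dots> = madj X ** X" using assms(1) by (simp add: unitary_def)
  finally have sq: "?S ** ?S = madj X ** X" .
  have "psd_sqrt (madj X ** X) = ?S"
    unfolding psd_sqrt_def
    by (rule the_equality) (use assms sq in \<open>auto intro: psd_square_unique\<close>)
  then show ?thesis by (simp add: trace_norm_def)
qed

text \<open>With \<open>c\<close> the supremum of the left-hand side over all contractions, positivity of
  \<open>(B - 1) S (B - 1)\<^sup>*\<close> gives \<open>2 Re tr (B S) \<le> Re tr (B\<^sup>* B S) + Re tr S \<le> c + Re tr S\<close>,
  because \<open>B\<^sup>* B\<close> is again a contraction; so \<open>2 c \<le> c + Re tr S\<close>.\<close>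
lemma Re_trace_contraction_psd_le:
  fixes S :: "complex^'n^'n"
  assumes S: "psd S" and B: "contraction B"
  shows "Re (trace (B ** S)) \<le> Re (trace S)"
proof -
  define K where "K = {B :: complex^'n^'n. contraction B}"
  define c where "c = (SUP B\<in>K. Re (trace (B ** S)))"
  have bdd: "bdd_above ((\<lambda>B. Re (trace (B ** S))) ` K)"
    by (rule bdd_aboveI2)
      (use norm_trace_contraction_le complex_Re_le_cmod order_trans in \<open>fastforce simp: K_def\<close>)
  have le_c: "Re (trace (B ** S)) \<le> c" if "contraction B" for B
    unfolding c_def using that by (intro cSUP_upper bdd) (simp add: K_def)
  have hS: "madj S = S" using S by (simp add: psd_iff)
  have step: "Re (trace (B ** S)) \<le> (c + Re (trace S)) / 2" if B: "contraction B" for B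
  proof -
    have "0 \<le> Re (trace ((B - mat 1) ** S ** madj (B - mat 1)))"
      unfolding Re_trace_conj using S by (intro sum_nonneg) (simp add: psd_iff)
    also have "(B - mat 1) ** S ** madj (B - mat 1)
        = B ** S ** madj B - B ** S - madj (B ** S) + S"
      by (simp add: madj_diff matrix_distribs madj_mult hS)
    also have "Re (trace \<dots>) = Re (trace (B ** S ** madj B)) - 2 * Re (trace (B ** S)) + Re (trace S)"
      by (simp add: trace_add trace_sub trace_madj)
    also have "trace (B ** S ** madj B) = trace ((madj B ** B) ** S)"
      by (subst trace_mul_sym) (simp add: matrix_mul_assoc)
    also have "Re \<dots> \<le> c"
      by (intro le_c contraction_mult contraction_madj B)
    finally show ?thesis by simp
  qed
  have "c \<le> (c + Re (trace S)) / 2"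
    unfolding c_def[symmetric]
    by (subst (1) c_def, rule cSUP_least) (use B step in \<open>auto simp: K_def\<close>)
  then show ?thesis using le_c[OF B] by simp
qed

text \<open>Inserting \<open>madj U ** U\<close> between \<open>A\<close> and \<open>X\<close>
  reduces to the positive case. As the bound is attained, the trace norm is the maximum of
  \<open>Re (trace (A ** X))\<close> over contractions; its further properties are read off from
  this.\<close>

lemma Re_trace_contraction_le:
  fixes X :: "complex^'n^'n"
  assumes A: "contraction A"
  shows "Re (trace (A ** X)) \<le> trace_norm X"
proof -
  obtain U where U: "unitary U" and psd: "psd (U ** X)" by (rule polar_decomposition)
  have "A ** X = (A ** madj U) ** (U ** X)"
    using U by (metis matrix_mul_assoc matrix_mul_lid unitary_def)
  then show ?thesis
    using Re_trace_contraction_psd_le[OF psd, of "A ** madj U"] A U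
    by (simp add: trace_norm_eq_trace_unitary[OF U psd] contraction_mult contraction_madj
        unitary_contraction)
qed

lemma trace_norm_attained:
  fixes X :: "complex^'n^'n"
  obtains A where "contraction A" and "trace_norm X = Re (trace (A ** X))"
  by (metis polar_decomposition trace_norm_eq_trace_unitary unitary_contraction)

lemma trace_norm_leI:
  fixes X :: "complex^'n^'n"
  assumes "\<And>A. contraction A \<Longrightarrow> Re (trace (A ** X)) \<le> c"
  shows "trace_norm X \<le> c"
  by (metis assms trace_norm_attained)

section \<open>Norm properties of the trace norm and comparison with the Euclidean norm\<close>

lemma contraction_0: "contraction 0"
  by (simp add: contraction_def)

lemma trace_norm_nonneg: "0 \<le> trace_norm X"
  using Re_trace_contraction_le[OF contraction_0, of X] by (simp add: trace_def)

lemma trace_norm_triangle: "trace_norm (X + Y) \<le> trace_norm X + trace_norm Y"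
  by (rule trace_norm_leI)
    (simp add: matrix_add_ldistrib trace_add add_mono Re_trace_contraction_le)

lemma trace_norm_0 [simp]: "trace_norm 0 = 0"
  by (rule antisym[OF trace_norm_leI trace_norm_nonneg]) (simp add: trace_def)

lemma norm_vector_smult: "norm (c *s x) = norm c * norm x" for x :: "complex^'n"
  by (simp add: norm_vec_def norm_mult L2_set_right_distrib)

lemma norm_axis: "norm (axis j c :: complex^'n) = norm c"
proof -
  have "axis j c = c *s (axis j 1 :: complex^'n)"
    by (simp add: vec_eq_iff axis_def)
  then show ?thesis
    by (simp add: norm_vector_smult norm_axis_1)
qed

lemma contraction_smat: "norm c \<le> 1 \<Longrightarrow> contraction A \<Longrightarrow> contraction (smat c A)"
  unfolding contraction_def smat_vector norm_vector_smult
  by (meson mult_left_le_one_le norm_ge_zero order_trans)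

text \<open>The sign of \<open>r\<close> is absorbed into the contraction, which gives one
  inequality; applying it to \<open>inverse r\<close> gives the other.\<close>

lemma trace_norm_scaleR: "trace_norm (r *\<^sub>R X) = \<bar>r\<bar> * trace_norm X"
proof -
  have le: "trace_norm (r *\<^sub>R X) \<le> \<bar>r\<bar> * trace_norm X" for r :: real and X :: "complex^'b^'b"
  proof (rule trace_norm_leI)
    fix A :: "complex^'b^'b" assume "contraction A"
    then have "Re (trace (smat (of_real (sgn r)) A ** X)) \<le> trace_norm X"
      by (intro Re_trace_contraction_le contraction_smat) (auto simp: sgn_real_def)
    then have "\<bar>r\<bar> * (sgn r * Re (trace (A ** X))) \<le> \<bar>r\<bar> * trace_norm X"
      by (intro mult_left_mono) (auto simp: smat_mult_left trace_smat)
    then show "Re (trace (A ** r *\<^sub>R X)) \<le> \<bar>r\<bar> * trace_norm X"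
      by (simp add: matrix_scalar_ac trace_scaleR abs_mult_sgn flip: mult.assoc scalar_matrix_assoc)
  qed
  show ?thesis
  proof (cases "r = 0")
    case False
    have "trace_norm X \<le> \<bar>inverse r\<bar> * trace_norm (r *\<^sub>R X)"
      using le[of "inverse r" "r *\<^sub>R X"] False by simp
    then have "\<bar>r\<bar> * trace_norm X \<le> trace_norm (r *\<^sub>R X)"
      using False by (simp add: field_simps)
    with le[of r X] show ?thesis by simp
  qed simp
qed

lemma norm_entry_le_trace_norm:
  fixes X :: "complex^'n^'n"
  shows "norm (X $ i $ j) \<le> trace_norm X"
proof (cases "X $ i $ j = 0")
  case False
  define w where "w = cnj (X $ i $ j) / of_real (norm (X $ i $ j))"
  have w: "norm w = 1" using False by (simp add: w_def norm_divide)
  \<comment> \<open>A matrix unit times a phase: it moves coordinate \<open>i\<close> to coordinate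
    \<open>j\<close>, so its trace against \<open>X\<close> extracts the single entry, rotated to
    its modulus.\<close>
  define A :: "complex^'n^'n" where "A = (\<chi> a b. if a = j then if b = i then w else 0 else 0)"
  have "A *v x = axis j (w * x $ i)" for x
    unfolding vec_eq_iff
  proof
    fix a
    show "(A *v x) $ a = axis j (w * x $ i) $ a"
      by (cases "a = j")
        (simp_all add: A_def matrix_vector_mult_def axis_def if_distrib[of "\<lambda>z. z * c" for c] cong: if_cong)
  qed
  then have "contraction A"
    by (simp add: contraction_def norm_axis norm_mult w Finite_Cartesian_Product.norm_nth_le)
  moreover have "trace (A ** X) = w * X $ i $ j"
  proof -
    have "(A ** X) $ a $ a = (if a = j then w * X $ i $ j else 0)" for a
      by (simp add: A_def matrix_matrix_mult_def if_distrib[of "\<lambda>z. z * c" for c] cong: if_cong)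
    then show ?thesis by (simp add: trace_def)
  qed
  moreover have "w * X $ i $ j = of_real (norm (X $ i $ j))"
    using False by (simp add: w_def field_simps power2_eq_square flip: complex_norm_square)
  ultimately show ?thesis
    using Re_trace_contraction_le[of A X] by simp
qed (simp add: trace_norm_nonneg)

lemma trace_norm_le_sum_entries: "trace_norm X \<le> (\<Sum>i\<in>UNIV. \<Sum>j\<in>UNIV. norm (X $ i $ j))"
  by (intro trace_norm_leI order_trans[OF complex_Re_le_cmod norm_trace_contraction_le])

lemma norm_matrix_le_trace_norm:
  fixes X :: "complex^'n^'n"
  shows "norm X \<le> (real CARD('n))\<^sup>2 * trace_norm X"
proof -
  have "norm X \<le> (\<Sum>i\<in>UNIV. norm (X $ i))"
    by (simp add: norm_vec_def L2_set_le_sum)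
  also have "\<dots> \<le> (\<Sum>i\<in>UNIV. \<Sum>j\<in>UNIV. norm (X $ i $ j))"
    by (intro sum_mono) (simp add: norm_vec_def[of "X $ _"] L2_set_le_sum)
  also have "\<dots> \<le> (\<Sum>i\<in>(UNIV::'n set). \<Sum>j\<in>(UNIV::'n set). trace_norm X)"
    by (intro sum_mono norm_entry_le_trace_norm)
  finally show ?thesis by (simp add: power2_eq_square)
qed

lemma trace_norm_le_norm_matrix:
  fixes X :: "complex^'n^'n"
  shows "trace_norm X \<le> (real CARD('n))\<^sup>2 * norm X"
proof -
  have "trace_norm X \<le> (\<Sum>i\<in>UNIV. \<Sum>j\<in>UNIV. norm (X $ i $ j))"
    by (rule trace_norm_le_sum_entries)
  also have "\<dots> \<le> (\<Sum>i\<in>(UNIV::'n set). \<Sum>j\<in>(UNIV::'n set). norm X)"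
    by (intro sum_mono) (meson Finite_Cartesian_Product.norm_nth_le order_trans)
  finally show ?thesis by (simp add: power2_eq_square)
qed

lemma trace_norm_eq_0_iff: "trace_norm X = 0 \<longleftrightarrow> X = 0"
  using norm_matrix_le_trace_norm[of X] by auto

section \<open>First-order contraction estimates for the generators\<close>

lemma norm_matrix_vector_le: "\<exists>c\<ge>0. \<forall>x. norm (A *v x) \<le> c * norm (x :: complex^'n)"
proof -
  have "bounded_linear ((*v) A)"
    by (simp add: linear_conv_bounded_linear[symmetric])
  then show ?thesis
    by (metis bounded_linear.nonneg_bounded mult.commute)
qed

text \<open>By cyclicity the pairing of \<open>B\<close> with the image of \<open>X\<close> is the
  pairing of \<open>C\<close> with \<open>X\<close>, where \<open>C\<close> is the dual map applied
  to \<open>B\<close>. Cauchy-Schwarz, once for vectors and once for pairs of reals, bounds the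
  operator norm of \<open>C\<close> by \<open>\<kappa>\<close>, so \<open>C\<close> divided by
  \<open>\<kappa>\<close> is a contraction.\<close>

lemma trace_norm_kraus_le:
  fixes K L :: "complex^'n^'n"
  assumes le: "\<And>x. (norm (K *v x))\<^sup>2 + (norm (L *v x))\<^sup>2 \<le> \<kappa> * (norm x)\<^sup>2" and "\<kappa> > 0"
  shows "trace_norm (K ** X ** madj K + L ** X ** madj L) \<le> \<kappa> * trace_norm X"
proof (rule trace_norm_leI)
  fix B :: "complex^'n^'n" assume B: "contraction B"
  define C where "C = madj K ** B ** K + madj L ** B ** L"
  have cs: "y \<bullet> (C *v x) \<le> \<kappa> * norm x * norm y" for x y
  proof -
    have "y \<bullet> (C *v x) = (K *v y) \<bullet> (B *v (K *v x)) + (L *v y) \<bullet> (B *v (L *v x))"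
      by (simp add: C_def matrix_vector_mult_add_rdistrib inner_add_right inner_madj[of y]
          flip: matrix_vector_mul_assoc)
    also have "\<dots> \<le> norm (K *v y) * norm (K *v x) + norm (L *v y) * norm (L *v x)"
      using B unfolding contraction_def
      by (intro add_mono order_trans[OF norm_cauchy_schwarz] mult_left_mono) auto
    also have "\<dots> = (norm (K *v y), norm (L *v y)) \<bullet> (norm (K *v x), norm (L *v x))"
      by simp
    also have "\<dots> \<le> norm (norm (K *v y), norm (L *v y)) * norm (norm (K *v x), norm (L *v x))"
      by (rule norm_cauchy_schwarz)
    also have "\<dots> \<le> sqrt (\<kappa> * (norm y)\<^sup>2) * sqrt (\<kappa> * (norm x)\<^sup>2)"
      using \<open>\<kappa> > 0\<close> by (intro mult_mono) (auto simp: norm_Pair intro: le)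
    also have "\<dots> = \<kappa> * norm x * norm y"
      using \<open>\<kappa> > 0\<close> by (simp add: real_sqrt_mult)
    finally show ?thesis .
  qed
  have "norm (C *v x) \<le> \<kappa> * norm x" for x
  proof (cases "C *v x = 0")
    case False
    have "norm (C *v x) * norm (C *v x) \<le> \<kappa> * norm x * norm (C *v x)"
      using cs[of "C *v x" x] by (simp only: power2_norm_eq_inner flip: power2_eq_square)
    with False show ?thesis
      by (simp only: mult_le_cancel_right) auto
  qed (use \<open>\<kappa> > 0\<close> in simp)
  then have "contraction (smat (of_real (1 / \<kappa>)) C)"
    unfolding contraction_def smat_vector norm_vector_smult norm_of_real
    using \<open>\<kappa> > 0\<close> by (simp add: pos_divide_le_eq mult.commute)
  then have "Re (trace (smat (of_real (1 / \<kappa>)) C ** X)) \<le> trace_norm X"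
    by (rule Re_trace_contraction_le)
  then have "Re (trace (C ** X)) \<le> \<kappa> * trace_norm X"
    using \<open>\<kappa> > 0\<close> by (simp add: smat_mult_left trace_smat field_simps flip: of_real_divide)
  moreover have "trace (B ** (M ** X ** madj M)) = trace (madj M ** B ** M ** X)" for M
    using trace_mul_sym[of "B ** (M ** X)" "madj M"] by (simp add: matrix_mul_assoc)
  ultimately show "Re (trace (B ** (K ** X ** madj K + L ** X ** madj L))) \<le> \<kappa> * trace_norm X"
    by (simp add: C_def matrix_distribs trace_add)
qed

text \<open>The case of one Kraus operator. The \<open>+ 1\<close> keeps the constant positive when
  \<open>c\<close> is 0.\<close>

lemma trace_norm_sandwich_le:
  fixes A :: "complex^'n^'n"
  assumes "\<And>x. norm (A *v x) \<le> c * norm x" "c \<ge> 0"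
  shows "trace_norm (A ** X ** madj A) \<le> (c\<^sup>2 + 1) * trace_norm X"
proof -
  have "(norm (A *v x))\<^sup>2 + (norm (0 *v x :: complex^'n))\<^sup>2 \<le> (c\<^sup>2 + 1) * (norm x)\<^sup>2" for x
    using power_mono[OF assms(1)[of x], of 2] by (simp add: power_mult_distrib distrib_right add_increasing2)
  from trace_norm_kraus_le[OF this, of X] show ?thesis by (simp add: add_nonneg_pos)
qed

text \<open>\<open>1 + h L\<close> agrees up to second order in \<open>h\<close> with a completely positive map whose Kraus
  operators \<open>K\<^sub>i\<close> satisfy \<open>\<Sum> K\<^sub>i\<^sup>* K\<^sub>i = 1 + O(h\<^sup>2)\<close>.\<close>
lemma trace_norm_euler_step_le:
  fixes T :: "('n::finite) lterm"
  assumes "lterm_valid T"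
  shows "\<exists>C\<ge>0. \<forall>h\<ge>0. \<forall>X. trace_norm (X + h *\<^sub>R lterm_sop T X) \<le> (1 + C * h\<^sup>2) * trace_norm X"
proof (cases T)
  case (Ham H)
  obtain c where c: "c \<ge> 0" "\<And>x. norm (H *v x) \<le> c * norm x"
    using norm_matrix_vector_le by blast
  have hH: "madj H = H" using assms Ham by (simp add: hermitian_def)
  have "trace_norm (X + h *\<^sub>R lterm_sop T X) \<le> (1 + (2 * c\<^sup>2 + 1) * h\<^sup>2) * trace_norm X"
    if h: "h \<ge> 0" for h X
  proof -
    \<comment> \<open>K X K* equals X - i h [H, X] + h^2 H X H, so the error is
      \<open>h\<^sup>2\<close> times a sandwich of \<open>X\<close>. The final constant adds
      \<open>c\<^sup>2\<close> from \<open>K\<close> and \<open>c\<^sup>2 + 1\<close> from this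
      sandwich.\<close>
    define K where "K = mat 1 - smat (\<i> * of_real h) H"
    have skew: "madj (smat \<i> H) = - smat \<i> H"
      by (simp add: madj_smat hH) (simp add: vec_eq_iff smat_def)
    have "v \<bullet> (smat \<i> H *v v) = - (v \<bullet> (smat \<i> H *v v))" for v
      using inner_madj[of v "smat \<i> H" v]
      by (simp add: skew inner_commute matrix_vector_mult_minus_left)
    \<comment> \<open>A skew-adjoint matrix has zero real quadratic form; this removes the term of
      first order in \<open>h\<close> from the squared norm of \<open>K *v x\<close>.\<close>
    then have orth: "v \<bullet> (smat \<i> H *v v) = 0" for v
      by (metis add.inverse_unique double_zero_sym eq_neg_iff_add_eq_0 mult_2 mult_zero_right)
    have "(norm (K *v x))\<^sup>2 + (norm (0 *v x :: complex^'n))\<^sup>2 \<le> (1 + h\<^sup>2 * c\<^sup>2) * (norm x)\<^sup>2" for x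
    proof -
      have "K *v x = x - h *\<^sub>R (smat \<i> H *v x)"
        by (simp add: K_def matrix_vector_mult_diff_rdistrib smat_vector)
           (simp add: vec_eq_iff scaleR_conv_of_real[where 'a=complex] mult_ac)
      moreover have "orthogonal x (h *\<^sub>R (smat \<i> H *v x))"
        by (simp add: orthogonal_def orth)
      ultimately have "(norm (K *v x))\<^sup>2 = (norm x)\<^sup>2 + h\<^sup>2 * (norm (H *v x))\<^sup>2"
        using norm_add_Pythagorean[of x "- (h *\<^sub>R (smat \<i> H *v x))"]
        by (simp add: orthogonal_def smat_vector norm_vector_smult power_mult_distrib)
      moreover have "(norm (H *v x))\<^sup>2 \<le> c\<^sup>2 * (norm x)\<^sup>2"
        using power_mono[OF c(2)[of x], of 2] by (simp add: power_mult_distrib)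
      ultimately show ?thesis
        using mult_left_mono[of "(norm (H *v x))\<^sup>2" "c\<^sup>2 * (norm x)\<^sup>2" "h\<^sup>2"]
        by (simp add: algebra_simps)
    qed
    then have "trace_norm (K ** X ** madj K) \<le> (1 + h\<^sup>2 * c\<^sup>2) * trace_norm X"
      using trace_norm_kraus_le[of K 0 "1 + h\<^sup>2 * c\<^sup>2" X] by (simp add: add_pos_nonneg)
    moreover have eq: "X + h *\<^sub>R lterm_sop T X = K ** X ** madj K + (- (h\<^sup>2)) *\<^sub>R (H ** X ** madj H)"
      unfolding K_def Ham
      by (simp add: madj_diff madj_smat hH matrix_distribs smat_mult_left smat_mult_right smat_smat)
         (simp add: vec_eq_iff smat_def scaleR_conv_of_real[where 'a=complex] algebra_simps power2_eq_square)
    moreover have "trace_norm (X + h *\<^sub>R lterm_sop T X)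
        \<le> trace_norm (K ** X ** madj K) + h\<^sup>2 * trace_norm (H ** X ** madj H)"
      unfolding eq by (rule order_trans[OF trace_norm_triangle]) (simp only: trace_norm_scaleR, simp)
    ultimately show ?thesis
      using mult_left_mono[OF trace_norm_sandwich_le[OF c(2,1), of X], of "h\<^sup>2"]
      by (simp add: algebra_simps)
  qed
  then show ?thesis by (intro exI[of _ "2 * c\<^sup>2 + 1"]) auto
next
  case (Diss L)
  define P where "P = madj L ** L"
  have hP: "madj P = P" by (simp add: P_def madj_mult)
  obtain c where c: "c \<ge> 0" "\<And>x. norm (P *v x) \<le> c * norm x"
    using norm_matrix_vector_le by blast
  have "trace_norm (X + h *\<^sub>R lterm_sop T X) \<le> (1 + (c\<^sup>2 + 1) * h\<^sup>2) * trace_norm X"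
    if h: "h \<ge> 0" for h X
  proof -
    \<comment> \<open>Here K X K* supplies the anticommutator and \<open>M\<close> the jump term. In
      the sum of squared norms the terms \<open>h * (x \<bullet> (P *v x))\<close> cancel, and the
      excess \<open>h\<^sup>2 / 4 * P ** X ** P\<close> is subtracted again below.\<close>
    define K where "K = mat 1 - (h / 2) *\<^sub>R P"
    define M where "M = sqrt h *\<^sub>R L"
    have "(norm (K *v x))\<^sup>2 + (norm (M *v x))\<^sup>2 \<le> (1 + h\<^sup>2 / 4 * c\<^sup>2) * (norm x)\<^sup>2" for x
    proof -
      have "K *v x = x - (h / 2) *\<^sub>R (P *v x)"
        by (simp add: K_def matrix_vector_mult_diff_rdistrib scaleR_matrix_vector)
      then have "(norm (K *v x))\<^sup>2 = (norm x)\<^sup>2 - h * (x \<bullet> (P *v x)) + h\<^sup>2 / 4 * (norm (P *v x))\<^sup>2"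
        by (simp only: power2_norm_eq_inner inner_diff_left inner_diff_right)
           (simp add: inner_commute power2_eq_square)
      moreover have "(norm (M *v x))\<^sup>2 = h * (x \<bullet> (P *v x))"
        using h
        by (simp add: M_def scaleR_matrix_vector power_mult_distrib power2_norm_eq_inner[of "L *v x"]
            inner_madj[of _ L] inner_commute P_def matrix_vector_mul_assoc)
      moreover have "(norm (P *v x))\<^sup>2 \<le> c\<^sup>2 * (norm x)\<^sup>2"
        using power_mono[OF c(2)[of x], of 2] by (simp add: power_mult_distrib)
      ultimately show ?thesis
        using mult_left_mono[of "(norm (P *v x))\<^sup>2" "c\<^sup>2 * (norm x)\<^sup>2" "h\<^sup>2 / 4"]
        by (simp add: algebra_simps)
    qed
    then have "trace_norm (K ** X ** madj K + M ** X ** madj M) \<le> (1 + h\<^sup>2 / 4 * c\<^sup>2) * trace_norm X"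
      using trace_norm_kraus_le[of K M "1 + h\<^sup>2 / 4 * c\<^sup>2" X] by (simp add: add_pos_nonneg)
    moreover have eq: "X + h *\<^sub>R lterm_sop T X
        = K ** X ** madj K + M ** X ** madj M + (- (h\<^sup>2 / 4)) *\<^sub>R (P ** X ** madj P)"
    proof -
      have M: "M ** X ** madj M = h *\<^sub>R (L ** X ** madj L)"
        using h by (simp add: M_def madj_scaleR matrix_scalar_ac flip: scalar_matrix_assoc)
      have K: "K ** X ** madj K = X - (h / 2) *\<^sub>R (P ** X + X ** P) + (h\<^sup>2 / 4) *\<^sub>R (P ** X ** P)"
        by (simp add: K_def madj_diff madj_scaleR hP matrix_distribs matrix_scalar_ac
            power2_eq_square algebra_simps flip: scalar_matrix_assoc)
      have T: "lterm_sop T X = L ** X ** madj L - (1 / 2) *\<^sub>R (P ** X + X ** P)"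
        using smat_of_real[of "1/2"] by (simp add: Diss P_def)
      show ?thesis unfolding M K T hP by (simp add: algebra_simps)
    qed
    \<comment> \<open>Slack for rounding \<open>(2 * c\<^sup>2 + 1) / 4\<close> up to
      \<open>c\<^sup>2 + 1\<close>.\<close>
    moreover have "h\<^sup>2 * trace_norm X \<ge> 0" by (simp add: trace_norm_nonneg)
    moreover have "h\<^sup>2 * (c\<^sup>2 * trace_norm X) \<ge> 0" by (simp add: trace_norm_nonneg)
    moreover have "trace_norm (X + h *\<^sub>R lterm_sop T X)
        \<le> trace_norm (K ** X ** madj K + M ** X ** madj M) + h\<^sup>2 / 4 * trace_norm (P ** X ** madj P)"
      unfolding eq by (rule order_trans[OF trace_norm_triangle]) (simp only: trace_norm_scaleR, simp)
    ultimately show ?thesis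
      using mult_left_mono[OF trace_norm_sandwich_le[OF c(2,1), of X], of "h\<^sup>2 / 4"]
      by (simp add: algebra_simps)
  qed
  then show ?thesis by (intro exI[of _ "c\<^sup>2 + 1"]) auto
qed

section \<open>Exponentials in Banach algebras\<close>

lemma exp_scaleR_of_nat_mult:
  fixes a :: "'a::{real_normed_algebra_1,banach}"
  shows "exp ((real m * h) *\<^sub>R a) = exp (h *\<^sub>R a) ^ m"
proof (induction m)
  case (Suc m)
  have "(real (Suc m) * h) *\<^sub>R a = h *\<^sub>R a + (real m * h) *\<^sub>R a"
    by (simp add: algebra_simps)
  then show ?case
    using Suc by (simp add: exp_add_commuting)
qed simp

text \<open>The exponential is cut into \<open>m\<close> steps of length \<open>h = s / m\<close>.
  Each differs from its Euler step by o(h), so its norm is at most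
  \<open>1 + e * h \<le> exp (e * h)\<close>, and all steps together give \<open>exp (e * s)\<close>
  with \<open>e\<close> arbitrarily small.\<close>

lemma norm_exp_le_1:
  fixes a :: "'a::{real_normed_algebra_1,banach}"
  assumes euler: "\<And>h. h \<ge> 0 \<Longrightarrow> norm (1 + h *\<^sub>R a) \<le> 1 + C * h\<^sup>2" and s: "s \<ge> 0"
  shows "norm (exp (s *\<^sub>R a)) \<le> 1"
proof (rule field_le_epsilon)
  fix \<epsilon> :: real assume "\<epsilon> > 0"
  \<comment> \<open>Chosen so that \<open>exp (e * s) \<le> 1 + \<epsilon>\<close>; the
    \<open>+ 1\<close> covers \<open>s = 0\<close>. One half of \<open>e\<close> pays for the
    derivative error, the other for the term with \<open>C\<close>.\<close>
  define e where "e = ln (1 + \<epsilon>) / (s + 1)"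
  have "e > 0" using \<open>\<epsilon> > 0\<close> s by (simp add: e_def)
  have "((\<lambda>t. exp (t *\<^sub>R a)) has_vector_derivative exp (0 *\<^sub>R a) * a) (at 0)"
    by (rule exp_scaleR_has_vector_derivative_right)
  then have "((\<lambda>t. exp (t *\<^sub>R a)) has_derivative (\<lambda>h. h *\<^sub>R a)) (at 0)"
    by (simp add: has_vector_derivative_def)
  from has_derivative_at_alt[THEN iffD1, OF this] \<open>e > 0\<close>
  obtain d where "d > 0"
    and d: "\<And>h. norm h < d \<Longrightarrow> norm (exp (h *\<^sub>R a) - 1 - h *\<^sub>R a) \<le> e / 2 * norm h"
    by (metis (no_types, lifting) diff_zero exp_zero half_gt_zero scaleR_zero_left)
  obtain m :: nat where m: "real m > max (s / d) (2 * \<bar>C\<bar> * s / e)"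
    using reals_Archimedean2 by blast
  define h where "h = s / real m"
  have "real m > 0" using m s \<open>d > 0\<close> by (smt (verit) divide_nonneg_pos max.cobounded1)
  have "h \<ge> 0" using s by (simp add: h_def)
  have "h < d" using m \<open>d > 0\<close> \<open>real m > 0\<close> by (simp add: h_def field_simps)
  have "\<bar>C\<bar> * h \<le> e / 2" using m \<open>e > 0\<close> \<open>real m > 0\<close> by (simp add: h_def field_simps)
  then have "\<bar>C\<bar> * h * h \<le> e / 2 * h" using \<open>h \<ge> 0\<close> by (rule mult_right_mono)
  moreover have "C * h\<^sup>2 \<le> \<bar>C\<bar> * h * h"
    unfolding power2_eq_square mult.assoc by (rule mult_right_mono) simp_all
  moreover have "norm (exp (h *\<^sub>R a)) \<le> norm (1 + h *\<^sub>R a) + norm (exp (h *\<^sub>R a) - 1 - h *\<^sub>R a)"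
    using norm_triangle_ineq[of "1 + h *\<^sub>R a" "exp (h *\<^sub>R a) - 1 - h *\<^sub>R a"] by simp
  ultimately have "norm (exp (h *\<^sub>R a)) \<le> 1 + e * h"
    using euler[OF \<open>h \<ge> 0\<close>] d[of h] \<open>h \<ge> 0\<close> \<open>h < d\<close> by simp
  also have "\<dots> \<le> exp (e * h)" by (rule exp_ge_add_one_self)
  finally have "norm (exp (h *\<^sub>R a)) ^ m \<le> exp (e * h) ^ m"
    by (rule power_mono) simp
  then have "norm (exp (h *\<^sub>R a) ^ m) \<le> exp (e * h) ^ m"
    by (rule order_trans[OF norm_power_ineq])
  then have "norm (exp (s *\<^sub>R a)) \<le> exp (e * s)"
    using \<open>real m > 0\<close> exp_scaleR_of_nat_mult[of m h a]
    by (simp add: h_def flip: exp_of_nat_mult)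
  also have "e * s \<le> ln (1 + \<epsilon>)"
    using s \<open>\<epsilon> > 0\<close> by (simp add: e_def field_simps mult_left_mono)
  then have "exp (e * s) \<le> 1 + \<epsilon>"
    using \<open>\<epsilon> > 0\<close> by (metis add_pos_pos exp_le_cancel_iff exp_ln zero_less_one)
  finally show "norm (exp (s *\<^sub>R a)) \<le> 1 + \<epsilon>" .
qed

lemma continuous_on_exp_scaleR:
  fixes a :: "'a::{real_normed_algebra_1,banach}"
  shows "continuous_on S (\<lambda>s. exp (s *\<^sub>R a))"
  unfolding continuous_on_eq_continuous_within
  by (blast intro: has_vector_derivative_continuous exp_scaleR_has_vector_derivative_right)

lemma norm_exp_diff_1_le:
  fixes a :: "'a::{real_normed_algebra_1,banach}"
  assumes contr: "\<And>s. s \<ge> 0 \<Longrightarrow> norm (exp (s *\<^sub>R a)) \<le> 1" and "s \<ge> 0"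
  shows "norm (exp (s *\<^sub>R a) - 1) \<le> s * norm a"
proof (cases "s = 0")
  case False
  have "norm (exp (s *\<^sub>R a) - exp (0 *\<^sub>R a)) \<le> s * norm a - 0 * norm a"
  proof (rule differentiable_bound_general[where f = "\<lambda>s. exp (s *\<^sub>R a)"
        and \<phi> = "\<lambda>s. s * norm a" and \<phi>' = "\<lambda>_. norm a" and f' = "\<lambda>s. exp (s *\<^sub>R a) * a"])
    fix x :: real assume "0 < x"
    then show "norm (exp (x *\<^sub>R a) * a) \<le> norm a"
      using contr[of x] by (intro norm_mult_ineq[THEN order_trans]) (simp add: mult_left_le_one_le)
    show "((\<lambda>s. s * norm a) has_vector_derivative norm a) (at x)"
      by (auto intro!: derivative_eq_intros simp flip: has_real_derivative_iff_has_vector_derivative)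
  qed (use False \<open>s \<ge> 0\<close> in \<open>auto intro!: continuous_intros continuous_on_exp_scaleR exp_scaleR_has_vector_derivative_right\<close>)
  then show ?thesis by simp
qed simp

text \<open>The derivative of the remainder is \<open>(exp (s *\<^sub>R a) - 1) * a\<close>, of norm
  at most \<open>s * (norm a)\<^sup>2\<close> by the first-order bound. Integrating it produces the
  factor 1/2.\<close>

lemma norm_exp_taylor2_le:
  fixes a :: "'a::{real_normed_algebra_1,banach}"
  assumes contr: "\<And>s. s \<ge> 0 \<Longrightarrow> norm (exp (s *\<^sub>R a)) \<le> 1" and "s \<ge> 0"
  shows "norm (exp (s *\<^sub>R a) - 1 - s *\<^sub>R a) \<le> s\<^sup>2 / 2 * (norm a)\<^sup>2"
proof (cases "s = 0")
  case False
  have "norm ((exp (s *\<^sub>R a) - 1 - s *\<^sub>R a) - (exp (0 *\<^sub>R a) - 1 - 0 *\<^sub>R a))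
      \<le> s\<^sup>2 / 2 * (norm a)\<^sup>2 - 0\<^sup>2 / 2 * (norm a)\<^sup>2"
  proof (rule differentiable_bound_general[where f = "\<lambda>s. exp (s *\<^sub>R a) - 1 - s *\<^sub>R a"
        and \<phi> = "\<lambda>s. s\<^sup>2 / 2 * (norm a)\<^sup>2" and \<phi>' = "\<lambda>s. s * (norm a)\<^sup>2"
        and f' = "\<lambda>s. (exp (s *\<^sub>R a) - 1) * a"])
    fix x :: real assume "0 < x"
    then show "norm ((exp (x *\<^sub>R a) - 1) * a) \<le> x * (norm a)\<^sup>2"
      using mult_right_mono[OF norm_exp_diff_1_le[OF contr, of x], of "norm a"]
      by (intro norm_mult_ineq[THEN order_trans]) (simp add: power2_eq_square mult.assoc)
    show "((\<lambda>s. s\<^sup>2 / 2 * (norm a)\<^sup>2) has_vector_derivative x * (norm a)\<^sup>2) (at x)"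
      by (auto intro!: derivative_eq_intros simp flip: has_real_derivative_iff_has_vector_derivative)
    show "((\<lambda>s. exp (s *\<^sub>R a) - 1 - s *\<^sub>R a) has_vector_derivative (exp (x *\<^sub>R a) - 1) * a) (at x)"
      by (auto intro!: derivative_eq_intros exp_scaleR_has_vector_derivative_right
          simp: algebra_simps)
  qed (use False \<open>s \<ge> 0\<close> in \<open>auto intro!: continuous_intros continuous_on_exp_scaleR\<close>)
  then show ?thesis by simp
qed simp

lemma norm_power_diff_le:
  fixes x y :: "'a::real_normed_algebra_1"
  assumes "norm x \<le> 1" "norm y \<le> 1"
  shows "norm (x ^ m - y ^ m) \<le> real m * norm (x - y)"
proof (induction m)
  case (Suc m)
  have "x ^ Suc m - y ^ Suc m = x * (x ^ m - y ^ m) + (x - y) * y ^ m"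
    by (simp add: algebra_simps)
  also have "norm \<dots> \<le> norm x * norm (x ^ m - y ^ m) + norm (x - y) * norm (y ^ m)"
    by (intro norm_triangle_mono norm_mult_ineq)
  also have "\<dots> \<le> 1 * (real m * norm (x - y)) + norm (x - y) * 1"
    using assms Suc norm_power_ineq[of y m] power_le_one[of "norm y" m]
    by (intro add_mono mult_mono) auto
  finally show ?case by (simp add: algebra_simps)
qed simp

text \<open>The variance of \<open>x\<close> under the weights \<open>p\<close> is
  nonnegative.\<close>

lemma weighted_sum_square_le:
  fixes p x :: "'i \<Rightarrow> real"
  assumes "\<And>k. k \<in> I \<Longrightarrow> p k \<ge> 0" "sum p I = 1"
  shows "(\<Sum>k\<in>I. p k * x k)\<^sup>2 \<le> (\<Sum>k\<in>I. p k * (x k)\<^sup>2)"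
proof -
  define \<mu> where "\<mu> = (\<Sum>k\<in>I. p k * x k)"
  have "0 \<le> (\<Sum>k\<in>I. p k * (x k - \<mu>)\<^sup>2)"
    using assms by (intro sum_nonneg) auto
  also have "\<dots> = (\<Sum>k\<in>I. p k * (x k)\<^sup>2 - 2 * \<mu> * (p k * x k) + \<mu>\<^sup>2 * p k)"
    by (intro sum.cong) (auto simp: power2_diff algebra_simps)
  also have "\<dots> = (\<Sum>k\<in>I. p k * (x k)\<^sup>2) - 2 * \<mu> * \<mu> + \<mu>\<^sup>2"
    using assms(2) by (simp add: sum.distrib sum_subtractf flip: sum_distrib_left \<mu>_def)
  finally show ?thesis by (simp add: \<mu>_def power2_eq_square)
qed

lemma norm_convex_sum_le:
  fixes f :: "'i \<Rightarrow> 'a::real_normed_vector"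
  assumes "\<And>k. k \<in> I \<Longrightarrow> p k \<ge> 0" "\<And>k. k \<in> I \<Longrightarrow> norm (f k) \<le> B k"
  shows "norm (\<Sum>k\<in>I. p k *\<^sub>R f k) \<le> (\<Sum>k\<in>I. p k * B k)"
  by (rule sum_norm_le) (use assms in \<open>auto intro!: mult_left_mono\<close>)

lemma norm_exp_average_diff_le:
  fixes a :: "'i \<Rightarrow> 'a::{real_normed_algebra_1,banach}"
  assumes p: "\<And>k. k \<in> I \<Longrightarrow> p k \<ge> 0" "sum p I = 1"
    and euler: "\<And>k h. k \<in> I \<Longrightarrow> h \<ge> 0 \<Longrightarrow> norm (1 + h *\<^sub>R a k) \<le> 1 + C k * h\<^sup>2"
    and \<tau>: "\<tau> \<ge> 0"
  shows "norm (exp ((real N * \<tau>) *\<^sub>R (\<Sum>k\<in>I. p k *\<^sub>R a k)) - (\<Sum>k\<in>I. p k *\<^sub>R exp (\<tau> *\<^sub>R a k)) ^ N)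
    \<le> real N * (\<tau>\<^sup>2 * (\<Sum>k\<in>I. p k * (norm (a k))\<^sup>2))"
proof -
  define M where "M = (\<Sum>k\<in>I. p k *\<^sub>R a k)"
  define E where "E = (\<Sum>k\<in>I. p k *\<^sub>R exp (\<tau> *\<^sub>R a k))"
  define Q where "Q = (\<Sum>k\<in>I. p k * (norm (a k))\<^sup>2)"
  have one: "(\<Sum>k\<in>I. p k *\<^sub>R 1) = (1 :: 'a)"
    using p(2) by (simp flip: scaleR_sum_left)
  have contr: "norm (exp (s *\<^sub>R a k)) \<le> 1" if "k \<in> I" "s \<ge> 0" for k s
    using euler[OF that(1)] that(2) by (rule norm_exp_le_1)
  \<comment> \<open>Euler estimates survive averaging because the weights sum to 1, so the averaged
    generator meets the same criterion and no product formula is involved.\<close>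
  have contr_M: "norm (exp (s *\<^sub>R M)) \<le> 1" if "s \<ge> 0" for s
    using _ that
  proof (rule norm_exp_le_1)
    fix h :: real assume "h \<ge> 0"
    have "1 + h *\<^sub>R M = (\<Sum>k\<in>I. p k *\<^sub>R (1 + h *\<^sub>R a k))"
      by (simp only: scaleR_right_distrib sum.distrib one)
         (simp add: M_def scaleR_sum_right mult.commute)
    also have "norm \<dots> \<le> (\<Sum>k\<in>I. p k * (1 + C k * h\<^sup>2))"
      by (intro norm_convex_sum_le p euler \<open>h \<ge> 0\<close>)
    also have "\<dots> = 1 + (\<Sum>k\<in>I. p k * C k) * h\<^sup>2"
      using p(2) by (simp add: algebra_simps sum.distrib sum_distrib_left)
    finally show "norm (1 + h *\<^sub>R M) \<le> 1 + (\<Sum>k\<in>I. p k * C k) * h\<^sup>2" .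
  qed
  have contr_E: "norm E \<le> 1"
    using norm_convex_sum_le[of I p "\<lambda>k. exp (\<tau> *\<^sub>R a k)" "\<lambda>_. 1"] p contr \<tau>
    by (simp add: E_def)
  have "norm M \<le> (\<Sum>k\<in>I. p k * norm (a k))"
    unfolding M_def by (intro norm_convex_sum_le p) auto
  \<comment> \<open>Jensen's inequality brings the error of \<open>exp (\<tau> *\<^sub>R M)\<close>
    into the same form \<open>Q\<close> as the error of the average.\<close>
  then have "(norm M)\<^sup>2 \<le> (\<Sum>k\<in>I. p k * norm (a k))\<^sup>2"
    by (rule power_mono) simp
  also have "\<dots> \<le> Q"
    unfolding Q_def by (rule weighted_sum_square_le[OF p])
  finally have M: "norm (exp (\<tau> *\<^sub>R M) - 1 - \<tau> *\<^sub>R M) \<le> \<tau>\<^sup>2 / 2 * Q"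
    by (intro norm_exp_taylor2_le[OF contr_M \<tau>, THEN order_trans] mult_left_mono) auto
  have "E - 1 - \<tau> *\<^sub>R M = (\<Sum>k\<in>I. p k *\<^sub>R (exp (\<tau> *\<^sub>R a k) - 1 - \<tau> *\<^sub>R a k))"
    by (simp only: scaleR_right_diff_distrib sum_subtractf one)
       (simp add: E_def M_def scaleR_sum_right mult.commute)
  also have "norm \<dots> \<le> (\<Sum>k\<in>I. p k * (\<tau>\<^sup>2 / 2 * (norm (a k))\<^sup>2))"
    by (intro norm_convex_sum_le p norm_exp_taylor2_le contr \<tau>)
  also have "\<dots> = \<tau>\<^sup>2 / 2 * Q"
    by (simp add: Q_def sum_distrib_left mult_ac)
  finally have E: "norm (E - 1 - \<tau> *\<^sub>R M) \<le> \<tau>\<^sup>2 / 2 * Q" .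
  have "norm (exp (\<tau> *\<^sub>R M) - E) \<le> \<tau>\<^sup>2 * Q"
    using norm_triangle_ineq4[of "exp (\<tau> *\<^sub>R M) - 1 - \<tau> *\<^sub>R M" "E - 1 - \<tau> *\<^sub>R M"] M E by simp
  then have "norm (exp (\<tau> *\<^sub>R M) ^ N - E ^ N) \<le> real N * (\<tau>\<^sup>2 * Q)"
    by (intro norm_power_diff_le[OF contr_M[OF \<tau>] contr_E, THEN order_trans] mult_left_mono) auto
  then show ?thesis
    by (simp only: exp_scaleR_of_nat_mult flip: M_def E_def Q_def)
qed

section \<open>Amplification of superoperators\<close>

text \<open>The system matrix found at ancilla indices \<open>p\<close> and \<open>q\<close>. In
  these coordinates \<open>tensor_id\<close> acts blockwise, so identities on the doubled space
  reduce to identities for each block.\<close>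

definition block :: "complex^('d\<times>'d)^('d\<times>'d) \<Rightarrow> 'd \<Rightarrow> 'd \<Rightarrow> complex^('d::finite)^'d" where
  "block X p q = (\<chi> a b. X $ (a, p) $ (b, q))"

definition ampl :: "complex^('d::finite)^'d \<Rightarrow> complex^('d\<times>'d)^('d\<times>'d)" where
  "ampl A = (\<chi> p q. if snd p = snd q then A $ fst p $ fst q else 0)"

lemma block_eqI: "(\<And>p q. block X p q = block Y p q) \<Longrightarrow> X = Y"
  by (simp add: vec_eq_iff block_def)

lemma block_tensor_id [simp]: "block (tensor_id \<Phi> X) p q = \<Phi> (block X p q)"
  by (simp add: vec_eq_iff block_def tensor_id_def)

lemma block_add: "block (X + Y) p q = block X p q + block Y p q"
  by (simp add: vec_eq_iff block_def)

lemma block_diff: "block (X - Y) p q = block X p q - block Y p q"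
  by (simp add: vec_eq_iff block_def)

lemma block_scaleR: "block (r *\<^sub>R X) p q = r *\<^sub>R block X p q"
  by (simp add: vec_eq_iff block_def)

lemma block_smat: "block (smat c X) p q = smat c (block X p q)"
  by (simp add: vec_eq_iff block_def smat_def)

lemma sum_UNIV_prod:
  "(\<Sum>k\<in>(UNIV :: ('d::finite \<times> 'd) set). f k) = (\<Sum>c\<in>UNIV. \<Sum>r\<in>UNIV. f (c, r))"
  by (simp add: sum.cartesian_product)

lemma block_ampl_mult: "block (ampl A ** X) p q = A ** block X p q"
  by (simp add: vec_eq_iff block_def ampl_def matrix_matrix_mult_def sum_UNIV_prod
      if_distribR if_distrib cong: if_cong)

lemma block_mult_ampl: "block (X ** ampl A) p q = block X p q ** A"
  by (simp add: vec_eq_iff block_def ampl_def matrix_matrix_mult_def sum_UNIV_prod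
      if_distribR if_distrib cong: if_cong)

lemma block_ampl: "block (ampl A) p q = (if p = q then A else 0)"
  by (simp add: vec_eq_iff block_def ampl_def)

lemma ampl_mult: "ampl (A ** B) = ampl A ** ampl B"
  by (rule block_eqI) (simp add: block_ampl_mult block_ampl)

lemma madj_ampl: "madj (ampl A) = ampl (madj A)"
  by (auto simp: vec_eq_iff madj_def ampl_def)

fun ampl_lterm :: "('d::finite) lterm \<Rightarrow> ('d \<times> 'd) lterm" where
  "ampl_lterm (Ham H) = Ham (ampl H)"
| "ampl_lterm (Diss L) = Diss (ampl L)"

lemma lterm_valid_ampl: "lterm_valid T \<Longrightarrow> lterm_valid (ampl_lterm T)"
  by (cases T) (auto simp: hermitian_def madj_ampl)

text \<open>Amplifying a term gives a term of the same kind on the doubled space, with H or L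
  replaced by its tensor product with the identity. Trace norm estimates for arbitrary terms thereby
  become diamond norm estimates.\<close>

lemma tensor_id_lterm_sop: "tensor_id (lterm_sop T) = lterm_sop (ampl_lterm T)"
proof (cases T)
  case (Ham H)
  then show ?thesis
    by (auto intro!: ext block_eqI simp: block_smat block_diff block_ampl_mult block_mult_ampl)
next
  case (Diss L)
  then show ?thesis
    by (auto intro!: ext block_eqI
        simp: block_smat block_diff block_add block_ampl_mult block_mult_ampl madj_ampl
        simp flip: ampl_mult)
qed

lemma tensor_id_id [simp]: "tensor_id (\<lambda>X. X) X = X"
  by (rule block_eqI) simp

lemma tensor_id_compose: "tensor_id (\<lambda>X. \<Phi> (\<Psi> X)) X = tensor_id \<Phi> (tensor_id \<Psi> X)"
  by (rule block_eqI) simp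

lemma tensor_id_add: "tensor_id (\<lambda>X. \<Phi> X + \<Psi> X) X = tensor_id \<Phi> X + tensor_id \<Psi> X"
  by (rule block_eqI) (simp add: block_add)

lemma tensor_id_scaleR: "tensor_id (\<lambda>X. r *\<^sub>R \<Phi> X) X = r *\<^sub>R tensor_id \<Phi> X"
  by (rule block_eqI) (simp add: block_scaleR)

lemma linear_tensor_id:
  assumes "linear \<Phi>" shows "linear (tensor_id \<Phi>)"
  by (rule linearI; rule block_eqI)
    (simp_all add: block_add block_scaleR linear_add[OF assms] linear_scale[OF assms])

lemma linear_lterm_sop: "linear (lterm_sop T)"
  by (cases T; rule linearI)
    (simp_all add: matrix_distribs matrix_scalar_ac smat_add smat_diff
      scaleR_right_diff_distrib scaleR_right_distrib flip: smat_of_real scalar_matrix_assoc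
      add: smat_smat smat_mult_left smat_mult_right mult.commute)

section \<open>The diamond norm\<close>

lemma trace_norm_linear_bounded:
  fixes f :: "complex^('m::finite)^'m \<Rightarrow> complex^('n::finite)^'n"
  assumes "linear f"
  shows "\<exists>c\<ge>0. \<forall>X. trace_norm (f X) \<le> c * trace_norm X"
proof -
  obtain b where b: "b \<ge> 0" "\<And>X. norm (f X) \<le> norm X * b"
    using assms bounded_linear.nonneg_bounded linear_conv_bounded_linear by blast
  have "trace_norm (f X) \<le> (real CARD('n))\<^sup>2 * b * (real CARD('m))\<^sup>2 * trace_norm X" for X
  proof -
    have "trace_norm (f X) \<le> (real CARD('n))\<^sup>2 * norm (f X)"
      by (rule trace_norm_le_norm_matrix)
    also have "\<dots> \<le> (real CARD('n))\<^sup>2 * (((real CARD('m))\<^sup>2 * trace_norm X) * b)"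
      using b by (intro mult_left_mono order_trans[OF b(2)] mult_right_mono
          norm_matrix_le_trace_norm) auto
    finally show ?thesis by (simp add: mult_ac)
  qed
  then show ?thesis
    using b(1) by (intro exI[of _ "(real CARD('n))\<^sup>2 * b * (real CARD('m))\<^sup>2"]) auto
qed

text \<open>A supremum of reals is informative only for bounded sets; every use of
  \<open>diamond_norm\<close> as an upper bound rests on this.\<close>

lemma bdd_above_diamond:
  assumes "linear \<Phi>"
  shows "bdd_above ((\<lambda>X. trace_norm (tensor_id \<Phi> X)) ` {X. trace_norm X \<le> 1})"
proof -
  obtain c where "c \<ge> 0" and c: "\<And>X. trace_norm (tensor_id \<Phi> X) \<le> c * trace_norm X"
    using trace_norm_linear_bounded[OF linear_tensor_id[OF assms]] by blast
  show ?thesis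
  proof (rule bdd_aboveI2)
    fix X assume "X \<in> {X :: complex^('a \<times> 'a)^('a \<times> 'a). trace_norm X \<le> 1}"
    then show "trace_norm (tensor_id \<Phi> X) \<le> c"
      using c[of X] \<open>c \<ge> 0\<close> mult_left_mono[of "trace_norm X" 1 c] by simp
  qed
qed

lemma trace_norm_tensor_id_le:
  assumes "linear \<Phi>"
  shows "trace_norm (tensor_id \<Phi> X) \<le> diamond_norm \<Phi> * trace_norm X"
proof (cases "trace_norm X = 0")
  case True
  then show ?thesis
    using linear_0[OF linear_tensor_id[OF assms]] by (simp add: trace_norm_eq_0_iff)
next
  case False
  then have pos: "trace_norm X > 0" using trace_norm_nonneg[of X] by simp
  let ?Y = "inverse (trace_norm X) *\<^sub>R X"
  have "trace_norm (tensor_id \<Phi> ?Y) \<le> diamond_norm \<Phi>"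
    unfolding diamond_norm_def
    by (intro cSUP_upper bdd_above_diamond assms) (use pos in \<open>simp add: trace_norm_scaleR\<close>)
  then show ?thesis
    using pos by (simp add: linear_scale[OF linear_tensor_id[OF assms]] trace_norm_scaleR field_simps)
qed

lemma diamond_norm_leI:
  assumes le: "\<And>X. trace_norm (tensor_id \<Phi> X) \<le> c * trace_norm X" and "c \<ge> 0"
  shows "diamond_norm \<Phi> \<le> c"
  unfolding diamond_norm_def
proof (rule cSUP_least)
  show "{X :: complex^('a \<times> 'a)^('a \<times> 'a). trace_norm X \<le> 1} \<noteq> {}"
    by (auto intro: exI[of _ 0])
  fix X assume "X \<in> {X :: complex^('a \<times> 'a)^('a \<times> 'a). trace_norm X \<le> 1}"
  then show "trace_norm (tensor_id \<Phi> X) \<le> c"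
    using le[of X] \<open>c \<ge> 0\<close> mult_left_mono[of "trace_norm X" 1 c] by simp
qed

lemma trace_norm_mat_1_pos: "trace_norm (mat 1 :: complex^'n^'n) > 0"
proof -
  have "trace_norm (mat 1 :: complex^'n^'n) \<noteq> 0"
    by (simp add: trace_norm_eq_0_iff vec_eq_iff mat_def)
  then show ?thesis
    using trace_norm_nonneg[of "mat 1 :: complex^'n^'n"] by simp
qed

lemma diamond_norm_nonneg:
  assumes "linear \<Phi>" shows "0 \<le> diamond_norm \<Phi>"
  using order_trans[OF trace_norm_nonneg trace_norm_tensor_id_le[OF assms, of "mat 1"]]
    trace_norm_mat_1_pos[where 'n = "'a \<times> 'a"]
  by (simp add: zero_le_mult_iff)

lemma diamond_norm_add_le:
  assumes "linear \<Phi>" "linear \<Psi>"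
  shows "diamond_norm (\<lambda>X. \<Phi> X + \<Psi> X) \<le> diamond_norm \<Phi> + diamond_norm \<Psi>"
proof (rule diamond_norm_leI)
  fix X
  show "trace_norm (tensor_id (\<lambda>X. \<Phi> X + \<Psi> X) X) \<le> (diamond_norm \<Phi> + diamond_norm \<Psi>) * trace_norm X"
    unfolding tensor_id_add distrib_right
    by (intro order_trans[OF trace_norm_triangle] add_mono trace_norm_tensor_id_le assms)
qed (intro add_nonneg_nonneg diamond_norm_nonneg assms)

lemma diamond_norm_compose_le:
  assumes "linear \<Phi>" "linear \<Psi>"
  shows "diamond_norm (\<lambda>X. \<Phi> (\<Psi> X)) \<le> diamond_norm \<Phi> * diamond_norm \<Psi>"
proof (rule diamond_norm_leI)
  fix X
  have "trace_norm (tensor_id \<Phi> (tensor_id \<Psi> X)) \<le> diamond_norm \<Phi> * trace_norm (tensor_id \<Psi> X)"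
    by (intro trace_norm_tensor_id_le assms)
  also have "\<dots> \<le> diamond_norm \<Phi> * (diamond_norm \<Psi> * trace_norm X)"
    by (intro mult_left_mono trace_norm_tensor_id_le diamond_norm_nonneg assms)
  finally show "trace_norm (tensor_id (\<lambda>X. \<Phi> (\<Psi> X)) X) \<le> diamond_norm \<Phi> * diamond_norm \<Psi> * trace_norm X"
    by (simp add: tensor_id_compose mult.assoc)
qed (intro mult_nonneg_nonneg diamond_norm_nonneg assms)

lemma diamond_norm_scaleR:
  assumes "linear \<Phi>"
  shows "diamond_norm (\<lambda>X. r *\<^sub>R \<Phi> X) = \<bar>r\<bar> * diamond_norm \<Phi>"
proof -
  have le: "diamond_norm (\<lambda>X. r *\<^sub>R \<Phi> X) \<le> \<bar>r\<bar> * diamond_norm \<Phi>"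
    if "linear \<Phi>" for r :: real and \<Phi> :: "('b::finite) sop"
    using that
    by (intro diamond_norm_leI)
      (auto simp: tensor_id_scaleR trace_norm_scaleR mult.assoc
        intro!: mult_left_mono mult_nonneg_nonneg trace_norm_tensor_id_le diamond_norm_nonneg)
  show ?thesis
  proof (cases "r = 0")
    case True
    then have "\<bar>r\<bar> * diamond_norm \<Phi> = 0" by simp
    then show ?thesis
      using le[OF assms, of r] diamond_norm_nonneg[OF linear_compose_scale_right[OF assms], of r]
      by linarith
  next
    case False
    have "linear (\<lambda>X. r *\<^sub>R \<Phi> X)" using assms by (rule linear_compose_scale_right)
    from le[OF this, of "inverse r"] False
    have "\<bar>r\<bar> * diamond_norm \<Phi> \<le> diamond_norm (\<lambda>X. r *\<^sub>R \<Phi> X)" by (simp add: field_simps)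
    with le[OF assms, of r] show ?thesis by simp
  qed
qed

lemma diamond_norm_id: "diamond_norm (\<lambda>X. X :: ('d::finite) cmat) = 1"
proof (rule antisym)
  show "diamond_norm (\<lambda>X. X :: 'd cmat) \<le> 1" by (rule diamond_norm_leI) auto
  show "1 \<le> diamond_norm (\<lambda>X. X :: 'd cmat)"
    using trace_norm_tensor_id_le[OF linear_ident, of "mat 1 :: complex^('d \<times> 'd)^('d \<times> 'd)"]
      trace_norm_mat_1_pos[where 'n = "'d \<times> 'd"]
    by simp
qed

lemma linear_block: "linear (\<lambda>X. block X p q)"
  by (rule linearI) (simp_all add: block_add block_scaleR)

text \<open>Every block of \<open>ext Y\<close> is \<open>Y\<close>, so \<open>\<Phi> Y\<close> is
  read off from one block of \<open>tensor_id \<Phi> (ext Y)\<close>. The constant does not depend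
  on \<open>\<Phi>\<close>, which yields both definiteness of the diamond norm and continuity of
  \<open>Rep_superop\<close>.\<close>

lemma trace_norm_apply_le_diamond_norm:
  "\<exists>c\<ge>0. \<forall>\<Phi> :: ('d::finite) sop. linear \<Phi> \<longrightarrow>
    (\<forall>Y. trace_norm (\<Phi> Y) \<le> c * diamond_norm \<Phi> * trace_norm Y)"
proof -
  fix p :: 'd
  define ext :: "'d cmat \<Rightarrow> complex^('d \<times> 'd)^('d \<times> 'd)"
    where "ext Y = (\<chi> p q. Y $ fst p $ fst q)" for Y
  have block_ext: "block (ext Y) p p = Y" for Y
    by (simp add: vec_eq_iff block_def ext_def)
  have "linear ext"
    by (rule linearI) (simp_all add: vec_eq_iff ext_def)
  then obtain a where a: "a \<ge> 0" "\<And>Y. trace_norm (ext Y) \<le> a * trace_norm Y"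
    using trace_norm_linear_bounded by blast
  obtain b where b: "b \<ge> 0" "\<And>X :: complex^('d \<times> 'd)^('d \<times> 'd). trace_norm (block X p p) \<le> b * trace_norm X"
    using trace_norm_linear_bounded[OF linear_block[of p p]] by blast
  have "trace_norm (\<Phi> Y) \<le> b * a * diamond_norm \<Phi> * trace_norm Y"
    if \<Phi>: "linear \<Phi>" for \<Phi> :: "'d sop" and Y
  proof -
    have "trace_norm (\<Phi> Y) = trace_norm (block (tensor_id \<Phi> (ext Y)) p p)"
      by (simp add: block_ext)
    also have "\<dots> \<le> b * (diamond_norm \<Phi> * (a * trace_norm Y))"
      using a b \<Phi>
      by (intro order_trans[OF b(2)] mult_left_mono order_trans[OF trace_norm_tensor_id_le]
          diamond_norm_nonneg)
    finally show ?thesis by (simp add: mult_ac)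
  qed
  then show ?thesis using a b by (intro exI[of _ "b * a"]) auto
qed

section \<open>The Banach algebra of superoperators\<close>

text \<open>A copy of the bounded linear maps, since that type already carries the operator norm as
  its class instance and a second norm needs a type of its own.\<close>

typedef ('d::finite) superop = "UNIV :: ('d cmat \<Rightarrow>\<^sub>L 'd cmat) set"
  by simp

setup_lifting type_definition_superop

instantiation superop :: (finite) real_normed_vector
begin

lift_definition zero_superop :: "'a superop" is 0 .
lift_definition plus_superop :: "'a superop \<Rightarrow> 'a superop \<Rightarrow> 'a superop" is "(+)" .
lift_definition minus_superop :: "'a superop \<Rightarrow> 'a superop \<Rightarrow> 'a superop" is "(-)" .
lift_definition uminus_superop :: "'a superop \<Rightarrow> 'a superop" is uminus .
lift_definition scaleR_superop :: "real \<Rightarrow> 'a superop \<Rightarrow> 'a superop" is "(*\<^sub>R)" .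
lift_definition norm_superop :: "'a superop \<Rightarrow> real" is "\<lambda>\<Phi>. diamond_norm (blinfun_apply \<Phi>)" .

definition dist_superop :: "'a superop \<Rightarrow> 'a superop \<Rightarrow> real"
  where "dist_superop a b = norm (a - b)"

definition sgn_superop :: "'a superop \<Rightarrow> 'a superop"
  where "sgn_superop a = scaleR (inverse (norm a)) a"

definition uniformity_superop :: "('a superop \<times> 'a superop) filter"
  where "uniformity_superop = (INF e\<in>{0 <..}. principal {(x, y). dist x y < e})"

definition open_superop :: "'a superop set \<Rightarrow> bool"
  where "open_superop S = (\<forall>x\<in>S. \<forall>\<^sub>F (x', y) in uniformity. x' = x \<longrightarrow> y \<in> S)"

instance
proof
  fix a b :: "'a superop" and r :: real
  have lin: "linear (blinfun_apply \<Phi>)" for \<Phi> :: "'a cmat \<Rightarrow>\<^sub>L 'a cmat"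
    by (simp add: blinfun.bounded_linear_right bounded_linear.linear)
  show "norm (a + b) \<le> norm a + norm b"
    by transfer (simp add: blinfun.add_left[abs_def] plus_blinfun.rep_eq diamond_norm_add_le lin)
  show "norm (r *\<^sub>R a) = \<bar>r\<bar> * norm a"
    by transfer (simp add: scaleR_blinfun.rep_eq diamond_norm_scaleR lin)
  show "norm a = 0 \<longleftrightarrow> a = 0"
  proof transfer
    fix \<Phi> :: "'a cmat \<Rightarrow>\<^sub>L 'a cmat"
    show "diamond_norm (blinfun_apply \<Phi>) = 0 \<longleftrightarrow> \<Phi> = 0"
    proof
      assume 0: "diamond_norm (blinfun_apply \<Phi>) = 0"
      obtain c where "\<And>Y. trace_norm (\<Phi> Y) \<le> c * diamond_norm (blinfun_apply \<Phi>) * trace_norm Y"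
        using trace_norm_apply_le_diamond_norm lin by blast
      then have "trace_norm (\<Phi> Y) = 0" for Y
        using trace_norm_nonneg[of "\<Phi> Y"] 0 by (metis antisym mult_zero_left mult_zero_right)
      then show "\<Phi> = 0"
        by (intro blinfun_eqI) (simp add: trace_norm_eq_0_iff)
    next
      assume "\<Phi> = 0"
      then show "diamond_norm (blinfun_apply \<Phi>) = 0"
        using diamond_norm_scaleR[OF linear_zero, of 0] by (simp add: zero_blinfun.rep_eq)
    qed
  qed
qed (unfold dist_superop_def sgn_superop_def uniformity_superop_def open_superop_def,
    (rule refl | transfer, simp add: algebra_simps)+)

end

instantiation superop :: (finite) real_normed_algebra_1
begin

lift_definition one_superop :: "'a superop" is id_blinfun .
lift_definition times_superop :: "'a superop \<Rightarrow> 'a superop \<Rightarrow> 'a superop" is "(o\<^sub>L)" .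

instance
proof
  fix a b c :: "'a superop" and r :: real
  have lin: "linear (blinfun_apply \<Phi>)" for \<Phi> :: "'a cmat \<Rightarrow>\<^sub>L 'a cmat"
    by (simp add: blinfun.bounded_linear_right bounded_linear.linear)
  show "a * b * c = a * (b * c)" by transfer (simp add: blinfun_eqI)
  show "1 * a = a" by transfer (simp add: blinfun_eqI)
  show "a * 1 = a" by transfer (simp add: blinfun_eqI)
  show "(a + b) * c = a * c + b * c" by transfer (simp add: bounded_bilinear.add_left[OF bounded_bilinear_blinfun_compose])
  show "a * (b + c) = a * b + a * c" by transfer (simp add: bounded_bilinear.add_right[OF bounded_bilinear_blinfun_compose])
  show "r *\<^sub>R a * b = r *\<^sub>R (a * b)" by transfer (simp add: bounded_bilinear.scaleR_left[OF bounded_bilinear_blinfun_compose])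
  show "a * r *\<^sub>R b = r *\<^sub>R (a * b)" by transfer (simp add: bounded_bilinear.scaleR_right[OF bounded_bilinear_blinfun_compose])
  show "norm (a * b) \<le> norm a * norm b"
    by transfer (simp add: blinfun_compose.rep_eq o_def diamond_norm_compose_le lin)
  show norm1: "norm (1 :: 'a superop) = 1"
    by transfer (simp add: id_blinfun.rep_eq diamond_norm_id)
  show "(0 :: 'a superop) \<noteq> 1"
    by (metis norm1 norm_zero zero_neq_one)
qed

end

section \<open>Evaluation of algebra elements and equivalence with the operator norm\<close>

abbreviation app :: "('d::finite) superop \<Rightarrow> 'd sop" where
  "app a \<equiv> blinfun_apply (Rep_superop a)"

lemma linear_app: "linear (app a)"
  by (simp add: blinfun.bounded_linear_right bounded_linear.linear)

lemma app_add: "app (a + b) X = app a X + app b X"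
  by (simp add: plus_superop.rep_eq blinfun.add_left)

lemma app_diff: "app (a - b) X = app a X - app b X"
  by (simp add: minus_superop.rep_eq blinfun.diff_left)

lemma app_scaleR: "app (r *\<^sub>R a) X = r *\<^sub>R app a X"
  by (simp add: scaleR_superop.rep_eq blinfun.scaleR_left)

lemma app_0: "app 0 X = 0"
  by (simp add: zero_superop.rep_eq)

lemma app_sum: "app (\<Sum>i\<in>I. a i) X = (\<Sum>i\<in>I. app (a i) X)"
  by (induction I rule: infinite_finite_induct) (simp_all add: app_0 app_add)

lemma app_1: "app 1 X = X"
  by (simp add: one_superop.rep_eq)

lemma app_mult: "app (a * b) X = app a (app b X)"
  by (simp add: times_superop.rep_eq)

lemma app_power: "app (a ^ m) = app a ^^ m"
  by (induction m) (auto simp: app_1 app_mult)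

lemma norm_superop_eq: "norm a = diamond_norm (app a)"
  by (simp add: norm_superop.rep_eq)

lemma bounded_linear_Rep_superop: "bounded_linear (Rep_superop :: 'd superop \<Rightarrow> ('d::finite) cmat \<Rightarrow>\<^sub>L 'd cmat)"
proof -
  obtain c where c: "c \<ge> 0" "\<And>(\<Phi> :: 'd sop) Y. linear \<Phi> \<Longrightarrow>
      trace_norm (\<Phi> Y) \<le> c * diamond_norm \<Phi> * trace_norm Y"
    using trace_norm_apply_le_diamond_norm by blast
  define d where "d = (real CARD('d))\<^sup>2"
  have "norm (app a Y) \<le> (norm a * (d * c * d)) * norm Y" for a :: "'d superop" and Y
  proof -
    have "norm (app a Y) \<le> d * trace_norm (app a Y)"
      unfolding d_def by (rule norm_matrix_le_trace_norm)
    also have "\<dots> \<le> d * (c * norm a * (d * norm Y))"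
      unfolding norm_superop_eq using c(1)
      by (intro mult_left_mono order_trans[OF c(2)[OF linear_app]] mult_nonneg_nonneg
          diamond_norm_nonneg[OF linear_app])
        (auto simp: d_def trace_norm_le_norm_matrix)
    finally show ?thesis by (simp add: mult_ac)
  qed
  then have "norm (Rep_superop a) \<le> norm a * (d * c * d)" for a :: "'d superop"
    using c(1) by (intro norm_blinfun_bound) (auto simp: d_def)
  then show ?thesis
    by (intro bounded_linear_intro[where K = "d * c * d"])
      (simp_all add: plus_superop.rep_eq scaleR_superop.rep_eq)
qed

text \<open>The converse half of the norm equivalence. Cauchy sequences pass through
  \<open>Rep_superop\<close> to the complete space of bounded linear maps, and their limits come
  back through \<open>Abs_superop\<close>.\<close>

lemma bounded_linear_Abs_superop: "bounded_linear (Abs_superop :: _ \<Rightarrow> ('d::finite) superop)"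
proof -
  have "\<exists>b\<ge>0. \<forall>X :: complex^('d \<times> 'd)^('d \<times> 'd). norm (block X p q) \<le> b * trace_norm X" for p q
  proof -
    obtain b where b: "b \<ge> 0" "\<And>X :: complex^('d \<times> 'd)^('d \<times> 'd).
        trace_norm (block X p q) \<le> b * trace_norm X"
      using trace_norm_linear_bounded[OF linear_block[of p q]] by blast
    have "norm (block X p q) \<le> (real CARD('d))\<^sup>2 * b * trace_norm X"
      for X :: "complex^('d \<times> 'd)^('d \<times> 'd)"
      using order_trans[OF norm_matrix_le_trace_norm mult_left_mono[OF b(2)[of X]]]
      by (simp add: mult.assoc)
    then show ?thesis using b(1) by (intro exI[of _ "(real CARD('d))\<^sup>2 * b"]) auto
  qed
  then obtain b where b: "\<And>p q. b p q \<ge> 0"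
    "\<And>p q (X :: complex^('d \<times> 'd)^('d \<times> 'd)). norm (block X p q) \<le> b p q * trace_norm X"
    by metis
  \<comment> \<open>Entry (k, l) of the amplified output depends only on the block at the ancilla
    parts of \<open>k\<close> and \<open>l\<close>; \<open>K\<close> sums these bounds over all
    entries.\<close>
  define K where "K = (\<Sum>k\<in>(UNIV :: ('d \<times> 'd) set). \<Sum>l\<in>(UNIV :: ('d \<times> 'd) set). b (snd k) (snd l))"
  have "norm (Abs_superop \<Phi>) \<le> norm \<Phi> * K" for \<Phi> :: "'d cmat \<Rightarrow>\<^sub>L 'd cmat"
  proof -
    have "trace_norm (tensor_id (blinfun_apply \<Phi>) X) \<le> norm \<Phi> * K * trace_norm X" for X
    proof -
      have entry: "norm (tensor_id (blinfun_apply \<Phi>) X $ k $ l) \<le> norm \<Phi> * (b (snd k) (snd l) * trace_norm X)"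
        for k l
      proof -
        have "tensor_id (blinfun_apply \<Phi>) X $ k $ l = \<Phi> (block X (snd k) (snd l)) $ fst k $ fst l"
          by (simp add: tensor_id_def block_def)
        also have "norm \<dots> \<le> norm (\<Phi> (block X (snd k) (snd l)))"
          by (meson Finite_Cartesian_Product.norm_nth_le order_trans)
        also have "\<dots> \<le> norm \<Phi> * norm (block X (snd k) (snd l))"
          by (rule norm_blinfun)
        also have "\<dots> \<le> norm \<Phi> * (b (snd k) (snd l) * trace_norm X)"
          by (intro mult_left_mono b) simp
        finally show ?thesis .
      qed
      have "trace_norm (tensor_id (blinfun_apply \<Phi>) X)
          \<le> (\<Sum>k\<in>(UNIV :: ('d \<times> 'd) set). \<Sum>l\<in>(UNIV :: ('d \<times> 'd) set). norm \<Phi> * (b (snd k) (snd l) * trace_norm X))"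
        by (intro order_trans[OF trace_norm_le_sum_entries] sum_mono entry)
      also have "\<dots> = norm \<Phi> * K * trace_norm X"
        by (simp only: K_def sum_distrib_left sum_distrib_right mult.assoc)
      finally show ?thesis .
    qed
    then have "diamond_norm (blinfun_apply \<Phi>) \<le> norm \<Phi> * K"
      by (rule diamond_norm_leI) (auto simp: K_def intro!: mult_nonneg_nonneg sum_nonneg b)
    then show ?thesis by (simp add: norm_superop.abs_eq)
  qed
  then show ?thesis
    by (intro bounded_linear_intro[where K = K])
      (simp_all add: plus_superop.abs_eq scaleR_superop.abs_eq)
qed

instance superop :: (finite) banach
proof
  fix X :: "nat \<Rightarrow> 'a superop"
  assume "Cauchy X"
  then have "Cauchy (\<lambda>n. Rep_superop (X n))"
    by (rule bounded_linear.Cauchy[OF bounded_linear_Rep_superop])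
  then obtain L where "(\<lambda>n. Rep_superop (X n)) \<longlonglongrightarrow> L"
    using Cauchy_convergent convergent_def by blast
  then have "(\<lambda>n. Abs_superop (Rep_superop (X n))) \<longlonglongrightarrow> Abs_superop L"
    by (rule bounded_linear.tendsto[OF bounded_linear_Abs_superop])
  then show "convergent X"
    by (auto simp: Rep_superop_inverse convergent_def)
qed

text \<open>\<open>sop_exp\<close> is a series of matrices, taken at each argument, whereas
  \<open>exp\<close> is a series in the algebra. Evaluation at \<open>X\<close> is bounded linear
  and so commutes with the sum.\<close>

lemma app_exp:
  fixes a :: "('d::finite) superop"
  shows "app (exp (s *\<^sub>R a)) = sop_exp s (app a)"
proof
  fix X :: "'d cmat"
  have "bounded_linear (\<lambda>a. app a X)"
    by (rule bounded_linear_compose[OF blinfun.bounded_linear_left bounded_linear_Rep_superop])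
  then have "app (exp (s *\<^sub>R a)) X = (\<Sum>m. app ((s *\<^sub>R a) ^ m /\<^sub>R fact m) X)"
    unfolding exp_def by (rule bounded_linear.suminf) (rule summable_exp_generic)
  moreover have "app ((s *\<^sub>R a) ^ m /\<^sub>R fact m) X = (s ^ m / fact m) *\<^sub>R (app a ^^ m) X" for m
    by (simp add: app_scaleR app_power divide_inverse mult.commute)
  ultimately show "app (exp (s *\<^sub>R a)) X = sop_exp s (app a) X"
    by (simp add: sop_exp_def)
qed

definition superop_of :: "('d::finite) sop \<Rightarrow> 'd superop" where
  "superop_of \<Phi> = Abs_superop (Blinfun \<Phi>)"

lemma app_superop_of: "linear \<Phi> \<Longrightarrow> app (superop_of \<Phi>) = \<Phi>"
  by (simp add: superop_of_def Abs_superop_inverse bounded_linear_Blinfun_apply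
      linear_conv_bounded_linear)

section \<open>The qDRIFT error bound\<close>

lemma norm_euler_step_le:
  assumes "lterm_valid T"
  shows "\<exists>C. \<forall>h\<ge>0. norm (1 + h *\<^sub>R superop_of (lterm_sop T)) \<le> 1 + C * h\<^sup>2"
proof -
  obtain C where "C \<ge> 0" and C: "\<And>h X. h \<ge> 0 \<Longrightarrow>
      trace_norm (X + h *\<^sub>R lterm_sop (ampl_lterm T) X) \<le> (1 + C * h\<^sup>2) * trace_norm X"
    using trace_norm_euler_step_le[OF lterm_valid_ampl[OF assms]] by blast
  have "norm (1 + h *\<^sub>R superop_of (lterm_sop T)) \<le> 1 + C * h\<^sup>2" if "h \<ge> 0" for h
  proof -
    have "app (1 + h *\<^sub>R superop_of (lterm_sop T)) = (\<lambda>X. X + h *\<^sub>R lterm_sop T X)"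
      by (simp add: fun_eq_iff app_add app_1 app_scaleR app_superop_of linear_lterm_sop)
    then show ?thesis
      using C[OF that] \<open>C \<ge> 0\<close> that unfolding norm_superop_eq
      by (auto intro!: diamond_norm_leI
          simp: tensor_id_add tensor_id_scaleR tensor_id_lterm_sop)
  qed
  then show ?thesis by blast
qed

theorem theorem1:
  fixes n :: nat and lam :: "nat \<Rightarrow> real" and T :: "nat \<Rightarrow> ('d::finite) lterm"
    and t :: real and r N :: nat
  assumes lam_nonneg: "\<And>k. k \<in> {1..n} \<Longrightarrow> lam k \<ge> 0"
    and valid: "\<And>k. k \<in> {1..n} \<Longrightarrow> lterm_valid (T k)"
    and Gamma_pos: "(\<Sum>k=1..n. lam k) > 0"
    and t_nonneg: "t \<ge> 0"
    and r_pos: "r > 0"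
    and N_def: "real N = real r * (\<Sum>k=1..n. lam k)"
  shows "diamond_norm (sop_exp t (generator n lam T) - (qdrift n lam T (t / real r)) ^^ N)
           \<le> t^2 * (\<Sum>k=1..n. lam k * (diamond_norm (lterm_sop (T k)))^2) / real r
       \<and> (\<forall>\<epsilon>>0. of_nat r \<ge> \<lceil>t^2 / \<epsilon> * (\<Sum>k=1..n. lam k * (diamond_norm (lterm_sop (T k)))^2)\<rceil>
               \<longrightarrow> diamond_norm (sop_exp t (generator n lam T) - (qdrift n lam T (t / real r)) ^^ N) \<le> \<epsilon>)"
proof -
  define \<Gamma> where "\<Gamma> = (\<Sum>k=1..n. lam k)"
  define p where "p k = lam k / \<Gamma>" for k
  define a where "a k = superop_of (lterm_sop (T k))" for k
  define \<tau> where "\<tau> = t / real r"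
  define S where "S = (\<Sum>k=1..n. lam k * (diamond_norm (lterm_sop (T k)))\<^sup>2)"
  define D where "D = diamond_norm (sop_exp t (generator n lam T) - qdrift n lam T (t / real r) ^^ N)"
  have \<Gamma>: "\<Gamma> > 0" using Gamma_pos by (simp add: \<Gamma>_def)
  have app_a: "app (a k) = lterm_sop (T k)" for k
    by (simp add: a_def app_superop_of linear_lterm_sop)
  obtain C where C: "\<And>k h. k \<in> {1..n} \<Longrightarrow> h \<ge> 0 \<Longrightarrow> norm (1 + h *\<^sub>R a k) \<le> 1 + C k * h\<^sup>2"
    using norm_euler_step_le[OF valid] unfolding a_def by metis
  have "sum p {1..n} = \<Gamma> / \<Gamma>"
    unfolding p_def sum_divide_distrib[symmetric] \<Gamma>_def ..
  then have p: "\<And>k. k \<in> {1..n} \<Longrightarrow> p k \<ge> 0" "sum p {1..n} = 1"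
    using lam_nonneg \<Gamma> by (auto simp: p_def)
  have N\<Gamma>: "real N = real r * \<Gamma>"
    by (simp only: N_def \<Gamma>_def)
  \<comment> \<open>The factor \<Gamma> turns the weights \<open>p k\<close> back into
    \<open>lam k\<close>, so the \<open>N\<close> steps of the averaged generator make up exactly
    time \<open>t\<close> of the full one.\<close>
  then have N\<tau>: "real N * \<tau> = t * \<Gamma>"
    using r_pos by (simp add: \<tau>_def)
  have "(real N * \<tau>) *\<^sub>R (\<Sum>k=1..n. p k *\<^sub>R a k) = t *\<^sub>R (\<Sum>k=1..n. lam k *\<^sub>R a k)"
    using \<Gamma> by (simp add: N\<tau> p_def scaleR_sum_right)
  moreover have "app (\<Sum>k=1..n. lam k *\<^sub>R a k) = generator n lam T"
    by (simp add: fun_eq_iff generator_def app_sum app_scaleR app_a)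
  ultimately have "app (exp ((real N * \<tau>) *\<^sub>R (\<Sum>k=1..n. p k *\<^sub>R a k))) = sop_exp t (generator n lam T)"
    by (simp add: app_exp)
  moreover have "app (\<Sum>k=1..n. p k *\<^sub>R exp (\<tau> *\<^sub>R a k)) = qdrift n lam T \<tau>"
    by (simp add: fun_eq_iff qdrift_def app_sum app_scaleR app_exp app_a p_def \<Gamma>_def)
  ultimately have eq: "app (exp ((real N * \<tau>) *\<^sub>R (\<Sum>k=1..n. p k *\<^sub>R a k))
      - (\<Sum>k=1..n. p k *\<^sub>R exp (\<tau> *\<^sub>R a k)) ^ N) = sop_exp t (generator n lam T) - qdrift n lam T \<tau> ^^ N"
    by (intro ext) (simp only: app_diff app_power minus_apply)
  have "D = norm (exp ((real N * \<tau>) *\<^sub>R (\<Sum>k=1..n. p k *\<^sub>R a k))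
      - (\<Sum>k=1..n. p k *\<^sub>R exp (\<tau> *\<^sub>R a k)) ^ N)"
    unfolding norm_superop_eq eq by (simp only: D_def \<tau>_def)
  also have "\<dots> \<le> real N * (\<tau>\<^sup>2 * (\<Sum>k=1..n. p k * (norm (a k))\<^sup>2))"
    by (rule norm_exp_average_diff_le[OF p C]) (simp_all add: \<tau>_def t_nonneg)
  also have "(\<Sum>k=1..n. p k * (norm (a k))\<^sup>2) = S / \<Gamma>"
    by (simp add: S_def p_def norm_superop_eq app_a sum_divide_distrib)
  \<comment> \<open>One factor \<open>r\<close> of \<open>N\<close> cancels against the square of
    \<open>\<tau> = t / r\<close>, leaving a single \<open>r\<close> in the denominator, and
    \<Gamma> cancels.\<close>
  also have "real N * (\<tau>\<^sup>2 * (S / \<Gamma>)) = t\<^sup>2 * S / real r"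
    using \<Gamma> r_pos
    by (simp add: N\<Gamma> \<tau>_def power_divide power2_eq_square)
  finally have main: "D \<le> t\<^sup>2 * S / real r" .
  have "D \<le> \<epsilon>" if "\<epsilon> > 0" and r: "of_nat r \<ge> \<lceil>t\<^sup>2 / \<epsilon> * S\<rceil>" for \<epsilon>
  proof -
    have "t\<^sup>2 / \<epsilon> * S \<le> real r" using r by (simp add: ceiling_le_iff)
    then have "t\<^sup>2 * S / real r \<le> \<epsilon>"
      using \<open>\<epsilon> > 0\<close> r_pos by (simp add: field_simps)
    with main show ?thesis by simp
  qed
  with main show ?thesis
    unfolding D_def S_def by blast
qed

end
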